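(* Let $\mathcal{A}$ be a stability-based algorithm. There exist constants $C_1, C_2, c>0$ (depending only on the constants of $\mathcal{A}$) such that the following holds. Let $d,n\ge1$, $0<\epsilon<1/2$, $0<\tau<1$, and let $T$ be an $\epsilon$-corrupted set of $n$ samples from a distribution on $\mathbb{R}^d$ with mean $\mu$ and (finite, nonzero) covariance $\Sigma$. Put $\epsilon'=C_1\left(\frac{\log(1/\tau)}{n}+\epsilon\right)$ and suppose $\epsilon'\le c$. Then $\mathcal{A}$, on input $T$ and $\epsilon'$, computes in polynomial time a vector $\widehat\mu$ such that, with probability at least $1-\tau$, $$\|\widehat\mu-\mu\|\le C_2\left(\sqrt{\frac{\operatorname{tr}(\Sigma)\,\max\{1,\log \mathrm{r}(\Sigma)\}}{n}}+\sqrt{\|\Sigma\|\epsilon}+\sqrt{\frac{\|\Sigma\|\log(1/\tau)}{n}}\right).$$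
   Context: $\|\cdot\|$ is the Euclidean norm of a vector and the spectral norm of a matrix; $\mathrm{r}(\Sigma)=\operatorname{tr}(\Sigma)/\|\Sigma\|$ for nonzero PSD $\Sigma$. Corruption (strong contamination model). $T$ is an $\epsilon$-corrupted version of a finite multiset $S$ if $T$ is obtained from $S$ by removing at most $\epsilon|S|$ points and replacing them by the same number of arbitrary points. An $\epsilon$-corrupted set of $n$ samples from a distribution $D$ is an $\epsilon$-corrupted version of a multiset $S$ of $n$ i.i.d. samples from $D$, where the adversary may inspect $S$ before choosing removals and replacements. Stability. For a finite multiset $S\subset\mathbb{R}^d$ and a fixed $\mu\in\mathbb{R}^d$, let $\mu_S=\frac1{|S|}\sum_{x\in S}x$ and $\overline{\Sigma}_S=\frac1{|S|}\sum_{x\in S}(x-\mu)(x-\mu)^T$. For $0<\epsilon<1/2$ and $\delta\ge\epsilon$, $S$ is $(\epsilon,\delta)$-stable with respect to $\mu$ and $\sigma^2$ if for every $S'\subseteq S$ with $|S'|\ge(1-\epsilon)|S|$: (i) $\|\mu_{S'}-\mu\|\le\sigma\delta$, and (ii) $\|\overline{\Sigma}_{S'}-\sigma^2 I\|\le\sigma^2\delta^2/\epsilon$. Stability-based algorithm. A polynomial-time algorithm $\mathcal{A}$, taking as input a parameter $\eta$ and a finite multiset $T\subset\mathbb{R}^d$ (but not $\sigma$ or $\delta$), for which there are constants $C_{\mathcal{A}},K_{\mathcal{A}}>0$ such that: whenever $T$ is an $\eta$-corrupted version of a multiset $S$ that contains $S'\subseteq S$ with $|S'|\ge(1-\eta)|S|$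 and $S'$ is $(C_{\mathcal{A}}\eta,\delta)$-stable with respect to $\mu$ and $\sigma^2$, the output $\widehat\mu$ satisfies $\|\widehat\mu-\mu\|\le K_{\mathcal{A}}\sigma\delta$. *)

theory Defs
  imports "HOL-Probability.Probability" "HOL-Computational_Algebra.Polynomial"
begin

(* The dimension d is an ordinary natural number rather than a type, because the constants
   of the theorem must not depend on it.  Vectors are functions on {..<d}, extensional outside,
   so that Rd d is the space of the product measure PiM {..<d} (%_. borel).  Matrices are
   functions of two indices, of which only those below d are ever used. *)

type_synonym vect = "nat \<Rightarrow> real"
type_synonym matr = "nat \<Rightarrow> nat \<Rightarrow> real"

definition Rd :: "nat \<Rightarrow> vect set" where
  "Rd d = {..<d} \<rightarrow>\<^sub>E UNIV"

abbreviation borel_Rd :: "nat \<Rightarrow> vect measure" where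
  "borel_Rd d \<equiv> (\<Pi>\<^sub>M i\<in>{..<d}. borel)"

definition vnorm :: "nat \<Rightarrow> vect \<Rightarrow> real" where
  "vnorm d v = L2_set v {..<d}"

definition mtrace :: "nat \<Rightarrow> matr \<Rightarrow> real" where
  "mtrace d A = (\<Sum>i<d. A i i)"

definition mat_vec :: "nat \<Rightarrow> matr \<Rightarrow> vect \<Rightarrow> vect" where
  "mat_vec d A v = (\<lambda>i. \<Sum>j<d. A i j * v j)"

definition spectral_norm :: "nat \<Rightarrow> matr \<Rightarrow> real" where
  "spectral_norm d A = (SUP v\<in>{v \<in> Rd d. vnorm d v \<le> 1}. vnorm d (mat_vec d A v))"

definition effective_rank :: "nat \<Rightarrow> matr \<Rightarrow> real" where
  "effective_rank d A = mtrace d A / spectral_norm d A"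

definition distribution_on_Rd :: "nat \<Rightarrow> vect measure \<Rightarrow> bool" where
  "distribution_on_Rd d D \<longleftrightarrow> prob_space D \<and> sets D = sets (borel_Rd d)"

definition mean_vec :: "nat \<Rightarrow> vect measure \<Rightarrow> vect" where
  "mean_vec d D = (\<lambda>i\<in>{..<d}. \<integral>x. x i \<partial>D)"

definition covariance :: "nat \<Rightarrow> vect measure \<Rightarrow> matr" where
  "covariance d D = (\<lambda>i j. \<integral>x. (x i - mean_vec d D i) * (x j - mean_vec d D j) \<partial>D)"

definition finite_covariance :: "nat \<Rightarrow> vect measure \<Rightarrow> bool" where
  "finite_covariance d D \<longleftrightarrow> (\<forall>i<d. integrable D (\<lambda>x. (x i)\<^sup>2))"

definition corrupted_version :: "nat \<Rightarrow> real \<Rightarrow> vect multiset \<Rightarrow> vect multiset \<Rightarrow> bool" where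
  "corrupted_version d \<epsilon> S T \<longleftrightarrow>
     (\<exists>R N. R \<subseteq># S \<and> real (size R) \<le> \<epsilon> * real (size S) \<and>
            size N = size R \<and> set_mset N \<subseteq> Rd d \<and> T = S - R + N)"

definition sample_space :: "nat \<Rightarrow> vect measure \<Rightarrow> (nat \<Rightarrow> vect) measure" where
  "sample_space n D = (\<Pi>\<^sub>M i\<in>{..<n}. D)"

definition sample_multiset :: "nat \<Rightarrow> (nat \<Rightarrow> vect) \<Rightarrow> vect multiset" where
  "sample_multiset n x = image_mset x (mset_set {..<n})"

(* The adversary is an arbitrary, not necessarily measurable, function of the whole sample. *)

definition corrupted_samples ::
    "nat \<Rightarrow> real \<Rightarrow> nat \<Rightarrow> vect measure \<Rightarrow> ((nat \<Rightarrow> vect) \<Rightarrow> vect multiset) \<Rightarrow> bool" where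
  "corrupted_samples d \<epsilon> n D T \<longleftrightarrow>
     (\<forall>x \<in> space (sample_space n D). corrupted_version d \<epsilon> (sample_multiset n x) (T x))"

(* Inner probability: adversary and algorithm need not be measurable, so P need not
   define an event.  For a measurable P this says that P has probability at least q. *)

definition with_probability_at_least :: "'a measure \<Rightarrow> real \<Rightarrow> ('a \<Rightarrow> bool) \<Rightarrow> bool" where
  "with_probability_at_least M q P \<longleftrightarrow> (\<exists>E \<in> sets M. q \<le> measure M E \<and> (\<forall>x\<in>E. P x))"

definition emp_mean :: "vect multiset \<Rightarrow> vect" where
  "emp_mean S = (\<lambda>i. (\<Sum>x\<in>#S. x i) / real (size S))"

(* Centred at the prescribed vector m, not at the empirical mean. *)

definition emp_second_moment :: "vect \<Rightarrow> vect multiset \<Rightarrow> matr" where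
  "emp_second_moment m S = (\<lambda>i j. (\<Sum>x\<in>#S. (x i - m i) * (x j - m j)) / real (size S))"

definition stable ::
    "nat \<Rightarrow> real \<Rightarrow> real \<Rightarrow> vect \<Rightarrow> real \<Rightarrow> vect multiset \<Rightarrow> bool" where
  "stable d \<epsilon> \<delta> m \<sigma> S \<longleftrightarrow>
     0 < \<epsilon> \<and> \<epsilon> < 1/2 \<and> \<epsilon> \<le> \<delta> \<and> S \<noteq> {#} \<and>
     (\<forall>S'. S' \<subseteq># S \<and> (1 - \<epsilon>) * real (size S) \<le> real (size S') \<longrightarrow>
        vnorm d (\<lambda>i. emp_mean S' i - m i) \<le> \<sigma> * \<delta> \<and>
        spectral_norm d (\<lambda>i j. emp_second_moment m S' i j - (if i = j then \<sigma>\<^sup>2 else 0))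
          \<le> \<sigma>\<^sup>2 * \<delta>\<^sup>2 / \<epsilon>)"

(* An algorithm is given by its output and its running time, as functions of the dimension, the
   parameter and the input multiset.  No machine model is fixed: the running time is an arbitrary
   step count.  Polynomial means polynomial in the number d * |T| of input coordinates. *)

record algorithm =
  result :: "nat \<Rightarrow> real \<Rightarrow> vect multiset \<Rightarrow> vect"
  runtime :: "nat \<Rightarrow> real \<Rightarrow> vect multiset \<Rightarrow> nat"

definition runs_within :: "algorithm \<Rightarrow> nat poly \<Rightarrow> nat \<Rightarrow> real \<Rightarrow> vect multiset \<Rightarrow> bool" where
  "runs_within A p d \<eta> T \<longleftrightarrow> runtime A d \<eta> T \<le> poly p (d * size T)"

definition polynomial_time :: "algorithm \<Rightarrow> bool" where
  "polynomial_time A \<longleftrightarrow>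
     (\<exists>p. \<forall>d \<eta> T. 1 \<le> d \<and> set_mset T \<subseteq> Rd d \<longrightarrow> runs_within A p d \<eta> T)"

definition stability_based :: "real \<Rightarrow> real \<Rightarrow> algorithm \<Rightarrow> bool" where
  "stability_based C K A \<longleftrightarrow>
     polynomial_time A \<and>
     (\<forall>d \<eta> \<delta> \<sigma> m S S' T.
        1 \<le> d \<and> 0 < \<sigma> \<and> m \<in> Rd d \<and>
        set_mset S \<subseteq> Rd d \<and> corrupted_version d \<eta> S T \<and>
        S' \<subseteq># S \<and> (1 - \<eta>) * real (size S) \<le> real (size S') \<and>
        stable d (C * \<eta>) \<delta> m \<sigma> S'
        \<longrightarrow> vnorm d (\<lambda>i. result A d \<eta> T i - m i) \<le> K * \<sigma> * \<delta>)"

end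

theory Submission
  imports Defs
begin

text \<open>The good subsample is selected online.  With \<open>z\<^sub>i = x\<^sub>i - \<mu>\<close>, keep \<open>z\<^sub>i\<close> unless its score is larger
  than 1, where the score adds up its squared length, its effect on a trace potential
  \<open>tr (T\<^sup>p)\<close> of the points kept so far, \<open>T = c I + \<Sigma> z z\<^sup>T\<close>, and its squared component along their sum, each
  divided by its conditional expectation times \<open>O(1/\<epsilon>')\<close>.  The score then has conditional mean \<open>O(\<epsilon>')\<close>,
  so an exponential supermartingale gives that the truncated scores add up to at most \<open>\<epsilon>' n\<close>
  with probability \<open>1 - \<tau>/2\<close>.  On that event few points are rejected, and the potential, hence the second
  moment of the kept points, is small in every direction; no matrix concentration inequality
  is needed.  The components along the running sum form a bounded-increment supermartingale of
  the same kind, and bound the norm of the sum of the kept points.  The two moment bounds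
  yield stability.  If \<open>\<epsilon>' n < 3\<close> the whole sample is stable by Markov's inequality, since then
  \<open>\<tau> \<ge> 1/2\<close>.\<close>

section \<open>Vectors and sums of rank-one operators\<close>

text \<open>The bound must not see the dimension, so the trace of \<open>T^p\<close> cannot be used
  as it stands: its identity part alone has trace \<open>d c^p\<close>. In the mean of
  \<open><z, T^p z>\<close> that part contributes only
  \<open>c^p tr(Sigma) = r c^p ||Sigma||\<close>, which is why the potential counts it r times. A
  potential of at most \<open>r c^p e^x\<close> bounds the largest eigenvalue by
  \<open>c (r e^x)^(1/p)\<close>, which is O(c) once p is at least ln r + x. The shift c = p L, with
  L the cap on squared lengths, is just large enough for one more point to change T by a relative
  factor 1 + 1/p, hence forms of degree below p by a factor at most e. With x of order n
  \<epsilon>'/r the eigenvalue bound has order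
  \<open>tr(Sigma) max(1, ln r)/\<epsilon>' + n ||Sigma||\<close>; the logarithm in the rate comes
  from here only. The other obstacle is that rejection biases the sum of the kept points. This bias
  is never estimated: the exponential of a kept increment is bounded by 1 + drift + score, with the
  drift before truncation, whose mean is zero.\<close>

definition ip :: "nat \<Rightarrow> vect \<Rightarrow> vect \<Rightarrow> real" where
  "ip d u v = (\<Sum>i<d. u i * v i)"

definition unit_vec :: "nat \<Rightarrow> vect" where
  "unit_vec e = (\<lambda>i. if i = e then 1 else 0)"

lemma ip_commute: "ip d u v = ip d v u"
  by (simp add: ip_def mult.commute)

lemma ip_nonneg [simp]: "0 \<le> ip d u u"
  by (simp add: ip_def sum_nonneg)

lemma ip_zero [simp]: "ip d (\<lambda>_. 0) v = 0" "ip d v (\<lambda>_. 0) = 0"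
  by (simp_all add: ip_def)

lemma ip_add_right: "ip d u (\<lambda>i. v i + w i) = ip d u v + ip d u w"
  by (simp add: ip_def algebra_simps sum.distrib)

lemma ip_add_left: "ip d (\<lambda>i. v i + w i) u = ip d v u + ip d w u"
  by (simp add: ip_def algebra_simps sum.distrib)

lemma ip_diff_right: "ip d u (\<lambda>i. v i - w i) = ip d u v - ip d u w"
  by (simp add: ip_def algebra_simps sum_subtractf)

lemma ip_scale_right: "ip d u (\<lambda>i. c * v i) = c * ip d u v"
  by (simp add: ip_def sum_distrib_left mult_ac)

lemma ip_scale_left: "ip d (\<lambda>i. c * v i) u = c * ip d v u"
  by (simp add: ip_def sum_distrib_left mult_ac)

lemma ip_sum_list_right:
  "ip d u (\<lambda>i. \<Sum>z\<leftarrow>zs. f z * z i) = (\<Sum>z\<leftarrow>zs. f z * ip d u z)"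
proof (induction zs)
  case (Cons a zs)
  then show ?case by (simp add: ip_add_right ip_scale_right)
qed simp

lemma ip_unit [simp]: "e < d \<Longrightarrow> ip d (unit_vec e) v = v e" "e < d \<Longrightarrow> ip d v (unit_vec e) = v e"
  by (simp_all add: ip_def unit_vec_def if_distrib[of "\<lambda>x. x * _"] if_distrib[of "\<lambda>x. _ * x"] cong: if_cong)

lemma ip_Cauchy_Schwarz: "(ip d u v)\<^sup>2 \<le> ip d u u * ip d v v"
  using Cauchy_Schwarz_ineq_sum[of u v "{..<d}"] by (simp add: ip_def power2_eq_square)

lemma vnorm_eq: "vnorm d v = sqrt (ip d v v)"
  by (simp add: vnorm_def L2_set_def ip_def power2_eq_square)

lemma vnorm_nonneg [simp]: "0 \<le> vnorm d v"
  by (simp add: vnorm_eq)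

lemma ip_le_vnorm: "\<bar>ip d u v\<bar> \<le> vnorm d u * vnorm d v"
proof -
  have "sqrt ((ip d u v)\<^sup>2) \<le> sqrt (ip d u u * ip d v v)"
    by (intro real_sqrt_le_mono ip_Cauchy_Schwarz)
  then show ?thesis by (simp add: vnorm_eq real_sqrt_mult)
qed

definition rank_one_sum :: "nat \<Rightarrow> vect list \<Rightarrow> vect \<Rightarrow> vect" where
  "rank_one_sum d zs v = (\<lambda>i. \<Sum>z\<leftarrow>zs. ip d z v * z i)"

text \<open>The matrix \<open>c I + sum of z z^T\<close> is kept as a map on vectors, so that its
  powers are \<open>^^\<close> and a new point is a \<open>Cons\<close>. Coordinates from d on are
  harmless, because \<open>ip\<close> does not look at them.\<close>

definition shifted_sum :: "nat \<Rightarrow> real \<Rightarrow> vect list \<Rightarrow> vect \<Rightarrow> vect" where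
  "shifted_sum d c zs v = (\<lambda>i. c * v i + rank_one_sum d zs v i)"

definition trace_op :: "nat \<Rightarrow> (vect \<Rightarrow> vect) \<Rightarrow> real" where
  "trace_op d P = (\<Sum>e<d. P (unit_vec e) e)"

text \<open>Operators that are finite sums of rank-one projections.  Using Gram representations in place of
  positive semidefiniteness makes the trace inequalities below immediate, without a spectral theorem.\<close>

definition gram :: "nat \<Rightarrow> (vect \<Rightarrow> vect) \<Rightarrow> bool" where
  "gram d P \<longleftrightarrow> (\<exists>ws. \<forall>u v. ip d u (P v) = (\<Sum>w\<leftarrow>ws. ip d w u * ip d w v))"

lemma gramI: "(\<And>u v. ip d u (P v) = (\<Sum>w\<leftarrow>ws. ip d w u * ip d w v)) \<Longrightarrow> gram d P"
  unfolding gram_def by blast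

lemma sum_list_upt_eq: "(\<Sum>e\<leftarrow>[0..<d]. f e) = (\<Sum>e<d. f e)"
  for f :: "nat \<Rightarrow> real"
  by (simp add: sum_list_sum_nth atLeast0LessThan)

lemma gram_trace:
  assumes "\<And>u v. ip d u (P v) = (\<Sum>w\<leftarrow>ws. ip d w u * ip d w v)"
  shows "trace_op d P = (\<Sum>w\<leftarrow>ws. ip d w w)"
proof -
  have "trace_op d P = (\<Sum>e<d. ip d (unit_vec e) (P (unit_vec e)))"
    unfolding trace_op_def by (intro sum.cong) auto
  also have "\<dots> = (\<Sum>e<d. \<Sum>w\<leftarrow>ws. w e * w e)"
    by (intro sum.cong) (auto simp: assms)
  also have "\<dots> = (\<Sum>w\<leftarrow>ws. ip d w w)"
    by (induction ws) (simp_all add: sum.distrib ip_def)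
  finally show ?thesis .
qed

lemma gram_nonneg: "gram d P \<Longrightarrow> 0 \<le> ip d u (P u)"
  unfolding gram_def by (auto intro!: sum_list_nonneg)

lemma gram_trace_nonneg: "gram d P \<Longrightarrow> 0 \<le> trace_op d P"
  unfolding gram_def using gram_trace[of d P] by (auto intro!: sum_list_nonneg)

text \<open>Cauchy-Schwarz on each factor w. This stands in for the fact that the largest eigenvalue
  is at most the trace.\<close>

lemma gram_le_trace:
  assumes "gram d P"
  shows "ip d v (P v) \<le> trace_op d P * ip d v v"
proof -
  obtain ws where ws: "\<And>u v. ip d u (P v) = (\<Sum>w\<leftarrow>ws. ip d w u * ip d w v)"
    using assms unfolding gram_def by blast
  have "ip d v (P v) = (\<Sum>w\<leftarrow>ws. ip d w v * ip d w v)" by (rule ws)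
  also have "\<dots> \<le> (\<Sum>w\<leftarrow>ws. ip d w w * ip d v v)"
    using ip_Cauchy_Schwarz by (intro sum_list_mono) (simp add: power2_eq_square)
  also have "\<dots> = trace_op d P * ip d v v"
    by (simp add: gram_trace[OF ws] sum_list_mult_const)
  finally show ?thesis .
qed

lemma sum_list_Cauchy_Schwarz:
  "(\<Sum>x\<leftarrow>xs. f x * g x)\<^sup>2 \<le> (\<Sum>x\<leftarrow>xs. (f x)\<^sup>2) * (\<Sum>x\<leftarrow>xs. (g x)\<^sup>2)"
  for f g :: "'a \<Rightarrow> real"
  unfolding sum_list_sum_nth length_map
  using Cauchy_Schwarz_ineq_sum[of "\<lambda>i. f (xs ! i)" "\<lambda>i. g (xs ! i)" "{0..<length xs}"]
  by (simp cong: sum.cong_simp)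

lemma gram_Cauchy_Schwarz:
  assumes "gram d P"
  shows "(ip d u (P v))\<^sup>2 \<le> ip d u (P u) * ip d v (P v)"
proof -
  obtain ws where ws: "\<And>u v. ip d u (P v) = (\<Sum>w\<leftarrow>ws. ip d w u * ip d w v)"
    using assms unfolding gram_def by blast
  show ?thesis unfolding ws
    using sum_list_Cauchy_Schwarz[of "\<lambda>w. ip d w u" "\<lambda>w. ip d w v" ws]
    by (simp add: power2_eq_square)
qed

lemma gram_id: "gram d (\<lambda>v. v)"
proof (rule gramI[where ws = "map unit_vec [0..<d]"])
  fix u v
  have "(\<Sum>w\<leftarrow>map unit_vec [0..<d]. ip d w u * ip d w v)
      = (\<Sum>e<d. ip d (unit_vec e) u * ip d (unit_vec e) v)"
    by (simp add: o_def sum_list_upt_eq)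
  also have "\<dots> = (\<Sum>e<d. u e * v e)" by (intro sum.cong) auto
  finally show "ip d u v = (\<Sum>w\<leftarrow>map unit_vec [0..<d]. ip d w u * ip d w v)"
    by (simp add: ip_def)
qed

lemma gram_add:
  assumes "gram d P" "gram d Q"
  shows "gram d (\<lambda>v i. P v i + Q v i)"
proof -
  obtain ws where ws: "\<And>u v. ip d u (P v) = (\<Sum>w\<leftarrow>ws. ip d w u * ip d w v)"
    using assms(1) unfolding gram_def by blast
  obtain ws' where ws': "\<And>u v. ip d u (Q v) = (\<Sum>w\<leftarrow>ws'. ip d w u * ip d w v)"
    using assms(2) unfolding gram_def by blast
  show ?thesis
    by (rule gramI[where ws = "ws @ ws'"]) (simp add: ip_add_right ws ws')
qed

lemma gram_scale:
  assumes "gram d P" "0 \<le> c"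
  shows "gram d (\<lambda>v i. c * P v i)"
proof -
  obtain ws where ws: "\<And>u v. ip d u (P v) = (\<Sum>w\<leftarrow>ws. ip d w u * ip d w v)"
    using assms(1) unfolding gram_def by blast
  show ?thesis
  proof (rule gramI[where ws = "map (\<lambda>w i. sqrt c * w i) ws"])
    fix u v
    have "c * (ip d w u * ip d w v) = ip d (\<lambda>i. sqrt c * w i) u * ip d (\<lambda>i. sqrt c * w i) v" for w
      using assms(2) by (simp add: ip_scale_left mult_ac flip: mult.assoc[of "sqrt c" "sqrt c"])
    then show "ip d u (\<lambda>i. c * P v i)
        = (\<Sum>w\<leftarrow>map (\<lambda>w i. sqrt c * w i) ws. ip d w u * ip d w v)"
      by (simp add: ip_scale_right ws o_def flip: sum_list_const_mult)
  qed
qed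

definition self_adj :: "nat \<Rightarrow> (vect \<Rightarrow> vect) \<Rightarrow> bool" where
  "self_adj d P \<longleftrightarrow> (\<forall>u v. ip d u (P v) = ip d (P u) v)"

text \<open>The factors of \<open>U P U\<close> are the vectors \<open>U w\<close>. Products are
  reached through such conjugations, because a product of two Gram operators need not be
  Gram.\<close>

lemma gram_conj:
  assumes "gram d P" "self_adj d U"
  shows "gram d (\<lambda>v. U (P (U v)))"
proof -
  obtain ws where ws: "\<And>u v. ip d u (P v) = (\<Sum>w\<leftarrow>ws. ip d w u * ip d w v)"
    using assms(1) unfolding gram_def by blast
  have U: "ip d u (U v) = ip d (U u) v" for u v
    using assms(2) unfolding self_adj_def by blast
  show ?thesis
    by (rule gramI[where ws = "map U ws"]) (simp add: U ws o_def)
qed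

lemma self_adj_funpow:
  assumes "self_adj d P"
  shows "ip d u ((P ^^ k) v) = ip d ((P ^^ k) u) v"
proof (induction k arbitrary: u)
  case (Suc k)
  have "ip d u ((P ^^ Suc k) v) = ip d (P u) ((P ^^ k) v)"
    using assms by (simp add: self_adj_def)
  also have "\<dots> = ip d ((P ^^ k) (P u)) v" by (rule Suc.IH)
  finally show ?case by (simp add: funpow_swap1)
qed simp

section \<open>Rank-one sums, their shifts, and powers of the shift\<close>

lemma ip_rank_one_sum: "ip d u (rank_one_sum d zs v) = (\<Sum>z\<leftarrow>zs. ip d z u * ip d z v)"
proof -
  have "ip d u (rank_one_sum d zs v) = (\<Sum>z\<leftarrow>zs. ip d z v * ip d u z)"
    unfolding rank_one_sum_def by (rule ip_sum_list_right)
  then show ?thesis by (simp add: ip_commute[of d u] mult.commute)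
qed

lemma self_adj_rank_one_sum: "self_adj d (rank_one_sum d zs)"
  unfolding self_adj_def
  by (metis (no_types, lifting) ip_commute ip_rank_one_sum map_eq_conv mult.commute)

lemma self_adj_shifted_sum: "self_adj d (shifted_sum d c zs)"
  using self_adj_rank_one_sum[of d zs]
  by (simp add: self_adj_def shifted_sum_def ip_add_right ip_add_left ip_scale_left ip_scale_right)

lemma gram_rank_one_sum: "gram d (rank_one_sum d zs)"
  by (rule gramI[where ws = zs]) (rule ip_rank_one_sum)

lemma rank_one_sum_add:
  "rank_one_sum d zs (\<lambda>i. u i + v i) = (\<lambda>i. rank_one_sum d zs u i + rank_one_sum d zs v i)"
  by (rule ext, induction zs) (simp_all add: rank_one_sum_def ip_add_right algebra_simps)

lemma rank_one_sum_scale: "rank_one_sum d zs (\<lambda>i. a * v i) = (\<lambda>i. a * rank_one_sum d zs v i)"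
  by (rule ext, induction zs) (simp_all add: rank_one_sum_def ip_scale_right algebra_simps)

lemma shifted_sum_add:
  "shifted_sum d c zs (\<lambda>i. u i + v i) = (\<lambda>i. shifted_sum d c zs u i + shifted_sum d c zs v i)"
  by (simp add: shifted_sum_def rank_one_sum_add algebra_simps)

lemma shifted_sum_scale: "shifted_sum d c zs (\<lambda>i. a * v i) = (\<lambda>i. a * shifted_sum d c zs v i)"
  by (simp add: shifted_sum_def rank_one_sum_scale algebra_simps)

lemma funpow_shifted_sum_add:
  "(shifted_sum d c zs ^^ k) (\<lambda>i. u i + v i)
    = (\<lambda>i. (shifted_sum d c zs ^^ k) u i + (shifted_sum d c zs ^^ k) v i)"
  by (induction k) (simp_all add: shifted_sum_add)

lemma funpow_shifted_sum_scale:
  "(shifted_sum d c zs ^^ k) (\<lambda>i. a * v i) = (\<lambda>i. a * (shifted_sum d c zs ^^ k) v i)"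
  by (induction k) (simp_all add: shifted_sum_scale)

lemma rank_one_shifted_commute:
  "rank_one_sum d zs (shifted_sum d c zs v) = shifted_sum d c zs (rank_one_sum d zs v)"
  by (simp add: shifted_sum_def rank_one_sum_add rank_one_sum_scale)

lemma gram_shifted_sum: "0 \<le> c \<Longrightarrow> gram d (shifted_sum d c zs)"
  unfolding shifted_sum_def using gram_add[OF gram_scale[OF gram_id] gram_rank_one_sum] by blast

text \<open>Powers are taken two at a time: \<open>T^(k+2) = T T^k T\<close> is a conjugation of
  \<open>T^k\<close>, hence the two base cases.\<close>

lemma gram_funpow_shifted:
  assumes "0 \<le> c"
  shows "gram d (shifted_sum d c zs ^^ k)"
proof (induction k rule: induct_nat_012)
  case 0
  then show ?case using gram_id by (simp add: id_def)
next
  case 1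
  then show ?case using gram_shifted_sum[OF assms] by simp
next
  case (ge2 k)
  have "shifted_sum d c zs ^^ Suc (Suc k)
      = (\<lambda>v. shifted_sum d c zs ((shifted_sum d c zs ^^ k) (shifted_sum d c zs v)))"
    by (rule ext) (simp add: funpow_swap1)
  then show ?case using gram_conj[OF ge2(1) self_adj_shifted_sum[of d c zs]] by simp
qed

text \<open>Write A for the rank-one sum. It commutes with T, so
  \<open>T^(k+2) A = T (T^k A) T\<close> is again a conjugation; the second base case is
  \<open>T A = c A + A A\<close>.\<close>

lemma gram_funpow_shifted_rank_one:
  assumes "0 \<le> c"
  shows "gram d (\<lambda>v. (shifted_sum d c zs ^^ k) (rank_one_sum d zs v))"
proof (induction k rule: induct_nat_012)
  case 0
  then show ?case using gram_rank_one_sum by simp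
next
  case 1
  have "gram d (\<lambda>v. rank_one_sum d zs (rank_one_sum d zs v))"
    using gram_conj[OF gram_id self_adj_rank_one_sum] .
  from gram_add[OF gram_scale[OF gram_rank_one_sum assms] this]
  show ?case by (simp add: shifted_sum_def)
next
  case (ge2 k)
  have "(\<lambda>v. (shifted_sum d c zs ^^ Suc (Suc k)) (rank_one_sum d zs v))
      = (\<lambda>v. shifted_sum d c zs ((shifted_sum d c zs ^^ k) (rank_one_sum d zs (shifted_sum d c zs v))))"
    by (rule ext) (simp add: funpow_swap1 rank_one_shifted_commute)
  then show ?case using gram_conj[OF ge2(1) self_adj_shifted_sum[of d c zs]] by simp
qed

lemma funpow_shifted_sum_Suc:
  "(shifted_sum d c zs ^^ Suc k) v
    = (\<lambda>i. c * (shifted_sum d c zs ^^ k) v i + (shifted_sum d c zs ^^ k) (rank_one_sum d zs v) i)"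
proof -
  have "(shifted_sum d c zs ^^ Suc k) v = (shifted_sum d c zs ^^ k) (shifted_sum d c zs v)"
    by (simp add: funpow_swap1)
  also have "\<dots> = (shifted_sum d c zs ^^ k) (\<lambda>i. c * v i + rank_one_sum d zs v i)"
    by (simp add: shifted_sum_def)
  finally show ?thesis by (simp add: funpow_shifted_sum_add funpow_shifted_sum_scale)
qed

text \<open>The recursion is \<open>T^(k+1) - c^(k+1) I = c (T^k - c^k I) + T^k A\<close> with A the
  rank-one sum. Removing the identity part is what later removes the dimension from the
  trace.\<close>

lemma gram_excess:
  assumes "0 \<le> c"
  shows "gram d (\<lambda>v i. (shifted_sum d c zs ^^ k) v i - c ^ k * v i)"
proof (induction k)
  case 0
  show ?case by (rule gramI[where ws = "[]"]) simp
next
  case (Suc k)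
  from gram_add[OF gram_scale[OF Suc assms] gram_funpow_shifted_rank_one[OF assms]]
  show ?case unfolding funpow_shifted_sum_Suc by (simp add: algebra_simps)
qed

section \<open>The trace potential\<close>

abbreviation power_form :: "nat \<Rightarrow> real \<Rightarrow> vect list \<Rightarrow> nat \<Rightarrow> vect \<Rightarrow> real" where
  "power_form d c zs k v \<equiv> ip d v ((shifted_sum d c zs ^^ k) v)"

lemma power_form_nonneg: "0 \<le> c \<Longrightarrow> 0 \<le> power_form d c zs k v"
  by (rule gram_nonneg[OF gram_funpow_shifted])

lemma power_form_Suc_ge:
  assumes "0 \<le> c"
  shows "c * power_form d c zs k v \<le> power_form d c zs (Suc k) v"
  unfolding funpow_shifted_sum_Suc
  using gram_nonneg[OF gram_funpow_shifted_rank_one[OF assms, where zs = zs and k = k], of d v]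
  by (simp add: ip_add_right ip_scale_right)

text \<open>Log-convexity says that the ratios of neighbours increase, so moving two indices apart
  raises the product. \<open>step\<close> compares two ratios in multiplied-out form, since terms
  may vanish; \<open>main\<close> moves both indices outwards until one of them is 0.\<close>

lemma log_convex_mult_le:
  fixes a :: "nat \<Rightarrow> real"
  assumes nonneg: "\<And>k. 0 \<le> a k" and lc: "\<And>k. (a (Suc k))\<^sup>2 \<le> a k * a (Suc (Suc k))"
  shows "a j * a i \<le> a 0 * a (i + j)"
proof -
  have step: "a (Suc k) * a (k + m) \<le> a k * a (Suc (k + m))" for k m
  proof (induction m)
    case (Suc m)
    show ?case
    proof (cases "a (k + m) = 0")
      case True
      then have "a (Suc (k + m)) = 0" using lc[of "k + m"] by simp
      then show ?thesis using nonneg by simp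
    next
      case False
      then have pos: "0 < a (k + m)" using nonneg[of "k + m"] by simp
      have "a (k + m) * (a (Suc k) * a (Suc (k + m))) = (a (Suc k) * a (k + m)) * a (Suc (k + m))"
        by simp
      also have "\<dots> \<le> (a k * a (Suc (k + m))) * a (Suc (k + m))"
        by (intro mult_right_mono Suc nonneg)
      also have "\<dots> = a k * (a (Suc (k + m)))\<^sup>2" by (simp add: power2_eq_square)
      also have "\<dots> \<le> a k * (a (k + m) * a (Suc (Suc (k + m))))"
        by (intro mult_left_mono lc nonneg)
      finally have "a (k + m) * (a (Suc k) * a (Suc (k + m)))
          \<le> a (k + m) * (a k * a (Suc (Suc (k + m))))" by (simp add: mult_ac)
      then show ?thesis using pos by simp
    qed
  qed simp
  have main: "a j * a (m + j) \<le> a 0 * a (m + j + j)" for j m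
  proof (induction j arbitrary: m)
    case (Suc j)
    have "a (Suc j) * a (m + Suc j) \<le> a j * a (Suc (m + Suc j))"
      using step[of j "Suc m"] by (simp add: add_ac)
    also have "\<dots> \<le> a 0 * a (m + Suc j + Suc j)"
      using Suc[of "Suc (Suc m)"] by (simp add: add_ac)
    finally show ?case .
  qed simp
  show ?thesis
    using main[of j "i - j"] main[of i "j - i"]
    by (cases "j \<le> i") (simp_all add: mult.commute add.commute)
qed

text \<open>The numbers \<open><v, T^k v>\<close> are the moments of the spectral measure of v.
  Their log-convexity is Cauchy-Schwarz for the form of \<open>T^k\<close> at v and T v.\<close>

lemma power_form_mult_le:
  assumes "0 \<le> c"
  shows "power_form d c zs j v * power_form d c zs i v \<le> ip d v v * power_form d c zs (i + j) v"
proof -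
  let ?T = "shifted_sum d c zs"
  have "(power_form d c zs (Suc k) v)\<^sup>2 \<le> power_form d c zs k v * power_form d c zs (Suc (Suc k)) v" for k
  proof -
    have "power_form d c zs (Suc k) v = ip d v ((?T ^^ k) (?T v))"
      by (simp add: funpow_swap1)
    moreover have "power_form d c zs (Suc (Suc k)) v = ip d (?T v) ((?T ^^ k) (?T v))"
    proof -
      have "(?T ^^ Suc (Suc k)) v = ?T ((?T ^^ k) (?T v))" by (simp add: funpow_swap1)
      then show ?thesis using self_adj_shifted_sum[of d c zs] by (simp add: self_adj_def)
    qed
    ultimately show ?thesis
      using gram_Cauchy_Schwarz[OF gram_funpow_shifted[OF assms, where zs = zs and k = k], of d v "?T v"] by simp
  qed
  from log_convex_mult_le[of "\<lambda>k. power_form d c zs k v", OF power_form_nonneg[OF assms] this]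
  show ?thesis by simp
qed

text \<open>Jensen's inequality for that spectral measure, obtained from log-convexity
  alone.\<close>

lemma power_form_one_power_le:
  assumes "0 \<le> c" "ip d v v = 1"
  shows "(power_form d c zs 1 v) ^ k \<le> power_form d c zs k v"
proof (induction k)
  case (Suc k)
  have "(power_form d c zs 1 v) ^ Suc k \<le> power_form d c zs 1 v * power_form d c zs k v"
    using Suc power_form_nonneg[OF assms(1), where d = d and v = v and zs = zs and k = 1] by (simp add: mult_left_mono)
  also have "\<dots> \<le> power_form d c zs (Suc k) v"
    using power_form_mult_le[OF assms(1), where d = d and v = v and zs = zs and j = 1 and i = k] assms(2) by simp
  finally show ?case .
qed (simp add: assms)

lemma shifted_sum_Cons: "shifted_sum d c (z # zs) v = (\<lambda>i. shifted_sum d c zs v i + ip d z v * z i)"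
  by (simp add: shifted_sum_def rank_one_sum_def algebra_simps)

text \<open>For \<open>U = T + z z^T\<close> the difference \<open>U^p - T^p\<close> telescopes into
  the sum of \<open>T^(p-1-i) z z^T U^i\<close>; each summand has rank one, so its trace is an inner
  product.\<close>

lemma trace_funpow_Cons:
  "trace_op d (shifted_sum d c (z # zs) ^^ p)
    = trace_op d (shifted_sum d c zs ^^ p)
      + (\<Sum>i<p. ip d ((shifted_sum d c zs ^^ (p - Suc i)) z) ((shifted_sum d c (z # zs) ^^ i) z))"
proof -
  let ?T = "shifted_sum d c zs" and ?U = "shifted_sum d c (z # zs)"
  have step: "trace_op d (\<lambda>v. (?T ^^ j) ((?U ^^ Suc i) v))
      = trace_op d (\<lambda>v. (?T ^^ Suc j) ((?U ^^ i) v)) + ip d ((?T ^^ j) z) ((?U ^^ i) z)" for i j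
  proof -
    have *: "(?T ^^ j) ((?U ^^ Suc i) v) e
        = (?T ^^ Suc j) ((?U ^^ i) v) e + ip d z ((?U ^^ i) v) * (?T ^^ j) z e" for v e
    proof -
      have "(?U ^^ Suc i) v = (\<lambda>i'. ?T ((?U ^^ i) v) i' + ip d z ((?U ^^ i) v) * z i')"
        by (simp add: shifted_sum_Cons)
      then show ?thesis
        by (simp only: funpow_shifted_sum_add funpow_shifted_sum_scale funpow_Suc_right o_apply)
    qed
    have "(\<Sum>e<d. ip d z ((?U ^^ i) (unit_vec e)) * (?T ^^ j) z e) = ip d ((?U ^^ i) z) ((?T ^^ j) z)"
      unfolding ip_def[of d "(?U ^^ i) z"]
      by (intro sum.cong refl) (simp add: self_adj_funpow[OF self_adj_shifted_sum])
    then show ?thesis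
      unfolding trace_op_def * by (simp add: sum.distrib ip_commute)
  qed
  have "trace_op d (\<lambda>v. (?T ^^ j) ((?U ^^ i) v))
      = trace_op d (?T ^^ (j + i)) + (\<Sum>k<i. ip d ((?T ^^ (j + i - Suc k)) z) ((?U ^^ k) z))" for i j
  proof (induction i arbitrary: j)
    case 0
    then show ?case by (simp add: trace_op_def)
  next
    case (Suc i)
    show ?case unfolding step using Suc[of "Suc j"] by simp
  qed
  from this[of 0 p] show ?thesis by (simp add: eta_contract_eq)
qed

text \<open>One factor U is peeled off at a time. Besides T it leaves a product
  \<open>a_j a_i\<close> of forms \<open>a_k = <z, T^k z>\<close>, at most
  \<open>|z|^2 a_(i+j) <= L a_(i+j) <= (L/c) a_(i+j+1)\<close>. The choice c = p L makes this the
  fraction 1/p of the main term.\<close>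

lemma cross_form_le:
  assumes "0 < L" "1 \<le> p" "c = real p * L" "ip d z z \<le> L"
  shows "ip d ((shifted_sum d c zs ^^ j) z) ((shifted_sum d c (z # zs) ^^ i) z)
      \<le> (1 + 1 / real p) ^ i * power_form d c zs (i + j) z"
proof (induction i arbitrary: j)
  case 0
  show ?case by (simp add: self_adj_funpow[OF self_adj_shifted_sum])
next
  case (Suc i)
  let ?T = "shifted_sum d c zs" and ?U = "shifted_sum d c (z # zs)"
  let ?a = "\<lambda>k. power_form d c zs k z" and ?q = "1 + 1 / real p"
  have c: "0 \<le> c" using assms by simp
  have "ip d ((?T ^^ j) z) ((?U ^^ Suc i) z)
      = ip d ((?T ^^ j) z) (?T ((?U ^^ i) z)) + ip d z ((?U ^^ i) z) * ip d ((?T ^^ j) z) z"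
    by (simp add: shifted_sum_Cons[of d c z zs "(?U ^^ i) z"] ip_add_right ip_scale_right)
  also have "\<dots> = ip d ((?T ^^ Suc j) z) ((?U ^^ i) z) + ip d ((?T ^^ 0) z) ((?U ^^ i) z) * ?a j"
    using self_adj_shifted_sum[of d c zs] by (simp add: self_adj_def ip_commute[of d "(?T ^^ j) z"])
  also have "\<dots> \<le> ?q ^ i * ?a (i + Suc j) + (?q ^ i * ?a (i + 0)) * ?a j"
    by (intro add_mono mult_right_mono Suc.IH power_form_nonneg c)
  also have "\<dots> = ?q ^ i * (?a (i + Suc j) + ?a j * ?a i)" by (simp add: algebra_simps)
  also have "\<dots> \<le> ?q ^ i * (?a (i + Suc j) + 1 / real p * ?a (i + Suc j))"
  proof -
    have "?a j * ?a i \<le> ip d z z * ?a (i + j)" by (rule power_form_mult_le[OF c])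
    also have "\<dots> \<le> L * ?a (i + j)" by (intro mult_right_mono assms power_form_nonneg c)
    also have "\<dots> = 1 / real p * (c * ?a (i + j))" using assms by simp
    also have "\<dots> \<le> 1 / real p * ?a (Suc (i + j))"
      by (intro mult_left_mono power_form_Suc_ge c) simp
    finally show ?thesis by (intro mult_left_mono add_left_mono) simp_all
  qed
  finally show ?case by (simp add: algebra_simps)
qed

lemma one_plus_inverse_power_le_exp:
  assumes "1 \<le> p" "i \<le> p"
  shows "(1 + 1 / real p) ^ i \<le> exp 1"
proof -
  have "(1 + 1 / real p) ^ i \<le> (1 + 1 / real p) ^ p"
    using assms by (intro power_increasing) auto
  also have "\<dots> \<le> exp (1 / real p) ^ p"
    by (intro power_mono) (use exp_ge_add_one_self[of "1 / real p"] in \<open>simp_all add: add_nonneg_nonneg\<close>)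
  also have "\<dots> = exp 1" using assms by (simp flip: exp_of_nat_mult)
  finally show ?thesis .
qed

text \<open>Each of the p cross forms is at most e times the form of degree p - 1. The number p of
  terms is absorbed by p = c/L and \<open>c T^(p-1) <= T^p\<close>.\<close>

lemma trace_funpow_Cons_le:
  assumes "0 < L" "1 \<le> p" "c = real p * L" "ip d z z \<le> L"
  shows "trace_op d (shifted_sum d c (z # zs) ^^ p)
    \<le> trace_op d (shifted_sum d c zs ^^ p) + exp 1 / L * power_form d c zs p z"
proof -
  let ?T = "shifted_sum d c zs" and ?U = "shifted_sum d c (z # zs)"
  have c: "0 < c" using assms by simp
  have "ip d ((?T ^^ (p - Suc i)) z) ((?U ^^ i) z) \<le> exp 1 * power_form d c zs (p - 1) z"
    if "i < p" for i
  proof -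
    have "ip d ((?T ^^ (p - Suc i)) z) ((?U ^^ i) z)
        \<le> (1 + 1 / real p) ^ i * power_form d c zs (i + (p - Suc i)) z"
      by (rule cross_form_le[OF assms])
    also have "\<dots> \<le> exp 1 * power_form d c zs (i + (p - Suc i)) z"
      using that assms c by (intro mult_right_mono one_plus_inverse_power_le_exp power_form_nonneg) auto
    finally show ?thesis using that by simp
  qed
  then have "(\<Sum>i<p. ip d ((?T ^^ (p - Suc i)) z) ((?U ^^ i) z))
      \<le> (\<Sum>i<p. exp 1 * power_form d c zs (p - 1) z)" by (intro sum_mono) auto
  also have "\<dots> = exp 1 / L * (c * power_form d c zs (p - 1) z)"
    using assms by (simp add: field_simps)
  also have "\<dots> \<le> exp 1 / L * power_form d c zs (Suc (p - 1)) z"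
    using c assms by (intro mult_left_mono power_form_Suc_ge) auto
  finally show ?thesis using assms(2) by (simp add: trace_funpow_Cons)
qed

text \<open>The first summand measures \<open>T\<^sup>p\<close> only against its value for the empty list, so the ambient
  dimension is replaced by the effective rank \<open>r\<close>.\<close>

definition potential :: "nat \<Rightarrow> real \<Rightarrow> nat \<Rightarrow> real \<Rightarrow> vect list \<Rightarrow> real" where
  "potential d c p r zs = (trace_op d (shifted_sum d c zs ^^ p) - real d * c ^ p) + r * c ^ p"

lemma trace_excess:
  "trace_op d (\<lambda>v i. (shifted_sum d c zs ^^ k) v i - c ^ k * v i)
    = trace_op d (shifted_sum d c zs ^^ k) - real d * c ^ k"
  by (simp add: trace_op_def sum_subtractf unit_vec_def)

lemma potential_ge: "0 \<le> c \<Longrightarrow> r * c ^ p \<le> potential d c p r zs"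
  using gram_trace_nonneg[OF gram_excess[where c = c and d = d and zs = zs and k = p]] by (simp add: trace_excess potential_def)

lemma funpow_shifted_Nil: "(shifted_sum d c [] ^^ k) v = (\<lambda>i. c ^ k * v i)"
  by (induction k) (simp_all add: shifted_sum_def rank_one_sum_def mult.assoc)

lemma potential_Nil: "potential d c p r [] = r * c ^ p"
  by (simp add: potential_def trace_op_def funpow_shifted_Nil unit_vec_def)

lemma potential_Cons_le:
  assumes "0 < L" "1 \<le> p" "c = real p * L" "ip d z z \<le> L"
  shows "potential d c p r (z # zs) \<le> potential d c p r zs + exp 1 / L * power_form d c zs p z"
  using trace_funpow_Cons_le[OF assms, of zs] by (simp add: potential_def)

text \<open>The identity part of \<open>T^p\<close> contributes \<open>c^p\<close>, at most its
  share \<open>r c^p\<close> of the potential because r is at least 1; the excess is bounded by its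
  trace.\<close>

lemma top_eigenvalue_le_potential:
  assumes "0 \<le> c" "1 \<le> r" "ip d v v = 1"
  shows "(c + (\<Sum>z\<leftarrow>zs. (ip d z v)\<^sup>2)) ^ p \<le> potential d c p r zs"
proof -
  have "power_form d c zs 1 v = c + (\<Sum>z\<leftarrow>zs. (ip d z v)\<^sup>2)"
    using assms by (simp add: shifted_sum_def ip_add_right ip_scale_right ip_rank_one_sum power2_eq_square)
  then have "(c + (\<Sum>z\<leftarrow>zs. (ip d z v)\<^sup>2)) ^ p \<le> power_form d c zs p v"
    using power_form_one_power_le[OF assms(1,3), of zs p] by simp
  also have "\<dots> = ip d v (\<lambda>i. (shifted_sum d c zs ^^ p) v i - c ^ p * v i) + c ^ p"
    using assms by (simp add: ip_diff_right ip_scale_right)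
  also have "\<dots> \<le> (trace_op d (shifted_sum d c zs ^^ p) - real d * c ^ p) + c ^ p"
    using gram_le_trace[OF gram_excess[OF assms(1), where zs = zs and k = p], of d v] assms(3) by (simp add: trace_excess)
  also have "\<dots> \<le> potential d c p r zs"
    using assms mult_right_mono[of 1 r "c ^ p"] by (simp add: potential_def)
  finally show ?thesis .
qed

section \<open>Online selection\<close>

definition vsum :: "vect list \<Rightarrow> vect" where
  "vsum zs = (\<lambda>i. \<Sum>z\<leftarrow>zs. z i)"

lemma vsum_simps [simp]: "vsum [] = (\<lambda>_. 0)" "vsum (z # zs) = (\<lambda>i. vsum zs i + z i)"
  by (simp_all add: vsum_def add.commute)

text \<open>The square root lies below its tangent at \<open>q^2\<close>.\<close>

lemma sqrt_add_le:
  assumes "0 < q" "0 \<le> q\<^sup>2 + h"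
  shows "sqrt (q\<^sup>2 + h) \<le> q + h / (2 * q)"
proof (rule real_le_lsqrt)
  have "0 \<le> (q\<^sup>2 + h) / (2 * q) + q / 2" using assms by (intro add_nonneg_nonneg) auto
  also have "\<dots> = q + h / (2 * q)" using assms by (simp add: field_simps power2_eq_square)
  finally show "0 \<le> q + h / (2 * q)" .
  have "(q + h / (2 * q))\<^sup>2 = q\<^sup>2 + h + (h / (2 * q))\<^sup>2"
    using assms by (simp add: field_simps power2_eq_square)
  then show "q\<^sup>2 + h \<le> (q + h / (2 * q))\<^sup>2" by simp
qed

lemma exp_le_one_plus_double:
  assumes "0 \<le> (t::real)" "t \<le> 1"
  shows "exp t \<le> 1 + 2 * t"
proof -
  have "exp t \<le> 1 + t + t\<^sup>2" using assms by (rule exp_bound)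
  also have "t\<^sup>2 \<le> t" using assms by (simp add: power2_eq_square mult_left_le)
  finally show ?thesis by simp
qed

text \<open>Negative t matters because drifts have either sign. For t = -s the claim follows from
  \<open>(1 + s) (1 - s + s^2) = 1 + s^3\<close>.\<close>

lemma exp_le_quadratic:
  assumes "\<bar>t\<bar> \<le> (1::real)"
  shows "exp t \<le> 1 + t + t\<^sup>2"
proof (cases "0 \<le> t")
  case True
  then show ?thesis using assms by (intro exp_bound) auto
next
  case False
  define s where "s = - t"
  have s: "0 < s" "s \<le> 1" using False assms by (auto simp: s_def)
  have "1 \<le> (1 + s) * (1 - s + s\<^sup>2)"
    using s by (simp add: algebra_simps power2_eq_square)
  also have "\<dots> \<le> exp s * (1 - s + s\<^sup>2)"
  proof (intro mult_right_mono)
    show "1 + s \<le> exp s" by (rule exp_ge_add_one_self)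
    show "0 \<le> 1 - s + s\<^sup>2" using s by simp
  qed
  finally have "exp (- s) \<le> 1 - s + s\<^sup>2" by (simp add: exp_minus field_simps)
  then show ?thesis by (simp add: s_def)
qed

text \<open>\<open>L\<close> caps squared lengths, \<open>thr\<close> caps the form
  \<open><z, T^p z>\<close> relative to the potential, \<open>Q\<close> is the unit for components
  along the running sum, and \<open>b\<close> smooths the norm of that sum. The relation
  \<open>r * thr = L\<close> reflects that the trace is r times the spectral norm.\<close>

locale selection =
  fixes d p :: nat and L thr Q b r :: real
  assumes L: "0 < L" and thr: "0 < thr" and Q: "0 < Q" and b: "0 < b" and r: "1 \<le> r"
    and p: "1 \<le> p" and r_thr: "r * thr = L"
begin

definition c :: real where "c = real p * L"

lemma c_pos: "0 < c"
  using L p by (simp add: c_def)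

text \<open>A smoothed norm of the running sum: it can be divided by, and the quadratic part
  \<open>|z|^2/(2 radius)\<close> of an increment is at most \<open>|z|^2/(2 b)\<close>.\<close>

definition radius :: "vect list \<Rightarrow> real" where
  "radius zs = sqrt (b\<^sup>2 + ip d (vsum zs) (vsum zs))"

text \<open>The linear part of the increment of \<open>radius\<close>, in units of \<open>Q\<close>.
  Dividing by the radius keeps its conditional second moment bounded however long the sum has
  become.\<close>

definition drift :: "vect list \<Rightarrow> vect \<Rightarrow> real" where
  "drift zs z = ip d (vsum zs) z / (Q * radius zs)"

definition score :: "vect list \<Rightarrow> vect \<Rightarrow> real" where
  "score zs z = ip d z z / L + power_form d c zs p z / (thr * potential d c p r zs) + (drift zs z)\<^sup>2"

text \<open>A point is rejected when it is too long, raises the trace potential too much, or points too far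
  along the current sum.  Each threshold depends on earlier points only, so the rejection
  probability is bounded by Markov's inequality conditionally on the past.\<close>

fun selected :: "(nat \<Rightarrow> vect) \<Rightarrow> nat \<Rightarrow> vect list" where
  "selected x 0 = []"
| "selected x (Suc i) =
    (if score (selected x i) (x i) \<le> 1 then x i # selected x i else selected x i)"

text \<open>Truncation serves twice: a rejected point costs exactly 1, so the total cost bounds the
  number of rejections, and the exponential of a cost is bounded linearly.\<close>

definition cost :: "(nat \<Rightarrow> vect) \<Rightarrow> nat \<Rightarrow> real" where
  "cost x i = min 1 (score (selected x i) (x i))"

definition gain :: "(nat \<Rightarrow> vect) \<Rightarrow> nat \<Rightarrow> real" where
  "gain x i = (if score (selected x i) (x i) \<le> 1 then drift (selected x i) (x i) else 0)"

lemma radius_ge: "b \<le> radius zs" and radius_pos: "0 < radius zs"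
proof -
  have "sqrt (b\<^sup>2) \<le> radius zs" unfolding radius_def by (intro real_sqrt_le_mono) simp
  then show "b \<le> radius zs" using b by simp
  then show "0 < radius zs" using b by linarith
qed

lemma potential_pos: "0 < potential d c p r zs"
proof -
  have "0 < r * c ^ p" using r c_pos by simp
  also have "\<dots> \<le> potential d c p r zs" using c_pos by (intro potential_ge) simp
  finally show ?thesis .
qed

lemma power_form_quotient_nonneg: "0 \<le> power_form d c zs p z / (thr * potential d c p r zs)"
  using power_form_nonneg[where c = c and d = d and v = z and zs = zs and k = p] c_pos thr potential_pos[of zs] by simp

lemma norm_quotient_nonneg: "0 \<le> ip d z z / L"
  using L by simp

lemma score_nonneg: "0 \<le> score zs z"
  using norm_quotient_nonneg[of z] power_form_quotient_nonneg[of z zs] by (simp add: score_def)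

lemma score_ge: "ip d z z / L \<le> score zs z"
  "power_form d c zs p z / (thr * potential d c p r zs) \<le> score zs z" "(drift zs z)\<^sup>2 \<le> score zs z"
  using norm_quotient_nonneg[of z] power_form_quotient_nonneg[of z zs] zero_le_power2[of "drift zs z"]
  unfolding score_def by linarith+

lemma cost_nonneg: "0 \<le> cost x i"
  using score_nonneg by (simp add: cost_def)

lemma length_selected: "real n - (\<Sum>i<n. cost x i) \<le> real (length (selected x n))"
proof (induction n)
  case (Suc n)
  then show ?case using cost_nonneg[of x n] by (auto simp: cost_def)
qed simp

lemma mset_selected: "mset (selected x n) \<subseteq># image_mset x (mset_set {..<n})"
proof (induction n)
  case (Suc n)
  then show ?case
    by (auto simp: lessThan_Suc intro: subset_mset.order_trans[OF Suc.IH])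
qed simp

lemma selected_cong: "(\<And>k. k < i \<Longrightarrow> x k = y k) \<Longrightarrow> selected x i = selected y i"
  by (induction i) auto

text \<open>An accepted point multiplies the potential by at most 1 + (e/L) thr score, and thr/L =
  1/r; a rejected one leaves it unchanged. The argument is deterministic.\<close>

lemma potential_selected:
  "potential d c p r (selected x n) \<le> r * c ^ p * exp (exp 1 / r * (\<Sum>i<n. cost x i))"
proof (induction n)
  case 0
  then show ?case by (simp add: potential_Nil)
next
  case (Suc n)
  let ?zs = "selected x n" and ?z = "x n" and ?\<Phi> = "potential d c p r"
  have step: "?\<Phi> (selected x (Suc n)) \<le> ?\<Phi> ?zs * exp (exp 1 / r * cost x n)"
  proof (cases "score ?zs ?z \<le> 1")
    case True
    have "ip d ?z ?z / L \<le> 1"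
      using score_ge(1)[of ?z ?zs] True by linarith
    then have "ip d ?z ?z \<le> L" using L by (simp add: field_simps)
    then have "?\<Phi> (?z # ?zs) \<le> ?\<Phi> ?zs + exp 1 / L * power_form d c ?zs p ?z"
      by (intro potential_Cons_le L p c_def)
    also have "\<dots> \<le> ?\<Phi> ?zs + exp 1 / L * (thr * ?\<Phi> ?zs * score ?zs ?z)"
      using score_ge(2)[where zs = ?zs and z = ?z] thr potential_pos[of ?zs] L
      by (intro add_left_mono mult_left_mono) (simp_all add: field_simps)
    also have "\<dots> = ?\<Phi> ?zs * (1 + exp 1 / r * cost x n)"
      using True L r r_thr thr by (simp add: cost_def field_simps)
    also have "\<dots> \<le> ?\<Phi> ?zs * exp (exp 1 / r * cost x n)"
      using potential_pos[of ?zs] by (intro mult_left_mono exp_ge_add_one_self) simp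
    finally show ?thesis using True by simp
  next
    case False
    have "1 \<le> exp (exp 1 / r * cost x n)" using cost_nonneg r by simp
    then show ?thesis using False potential_pos[of ?zs] by simp
  qed
  also have "\<dots> \<le> r * c ^ p * exp (exp 1 / r * (\<Sum>i<n. cost x i)) * exp (exp 1 / r * cost x n)"
    by (intro mult_right_mono Suc.IH) simp
  also have "\<dots> = r * c ^ p * exp (exp 1 / r * (\<Sum>i<Suc n. cost x i))"
    by (simp add: distrib_left exp_add)
  finally show ?case .
qed

text \<open>The tangent bound for the square root turns the cross term \<open>2 <s, z>\<close> of a
  squared sum into \<open>Q * drift\<close> and \<open>|z|^2\<close> into at most L cost/(2
  b).\<close>

lemma radius_selected:
  "radius (selected x n) \<le> b + Q * (\<Sum>i<n. gain x i) + L / (2 * b) * (\<Sum>i<n. cost x i)"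
proof (induction n)
  case 0
  then show ?case using b by (simp add: radius_def)
next
  case (Suc n)
  let ?zs = "selected x n" and ?z = "x n"
  have "radius (selected x (Suc n)) \<le> radius ?zs + Q * gain x n + L / (2 * b) * cost x n"
  proof (cases "score ?zs ?z \<le> 1")
    case True
    define q where "q = radius ?zs"
    define h where "h = 2 * ip d (vsum ?zs) ?z + ip d ?z ?z"
    have q: "0 < q" "b \<le> q" using radius_pos radius_ge by (simp_all add: q_def)
    have q2: "q\<^sup>2 = b\<^sup>2 + ip d (vsum ?zs) (vsum ?zs)"
      using ip_nonneg[of d "vsum ?zs"] by (simp add: q_def radius_def)
    have eq: "b\<^sup>2 + ip d (vsum (?z # ?zs)) (vsum (?z # ?zs)) = q\<^sup>2 + h"
      by (simp add: q2 h_def ip_add_left ip_add_right ip_commute[of d ?z "vsum ?zs"])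
    have "0 \<le> q\<^sup>2 + h" unfolding eq[symmetric] by (intro add_nonneg_nonneg) auto
    from sqrt_add_le[OF q(1) this]
    have "radius (?z # ?zs) \<le> q + h / (2 * q)" unfolding radius_def eq .
    also have "\<dots> = q + Q * drift ?zs ?z + ip d ?z ?z / (2 * q)"
      using q Q unfolding drift_def q_def[symmetric] h_def by (simp add: field_simps)
    also have "\<dots> \<le> q + Q * drift ?zs ?z + L * score ?zs ?z / (2 * b)"
    proof -
      have "ip d ?z ?z \<le> L * score ?zs ?z"
        using score_ge(1)[of ?z ?zs] L by (simp add: field_simps)
      then have "ip d ?z ?z / (2 * q) \<le> L * score ?zs ?z / (2 * b)"
        using q b L score_nonneg[of ?zs ?z] by (intro frac_le) auto
      then show ?thesis by simp
    qed
    finally show ?thesis using True by (simp add: q_def gain_def cost_def)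
  next
    case False
    then show ?thesis using cost_nonneg[of x n] L b by (simp add: gain_def)
  qed
  then show ?case using Suc.IH by (simp add: algebra_simps)
qed

text \<open>The hypothesis puts the factor in front of \<open>c^p\<close> below \<open>e^p\<close>,
  so the p-th root of the potential bound is c e, and e - 1 is at most 2. Unit vectors are treated,
  then rescaled.\<close>

lemma second_moment_selected:
  assumes "ln r + exp 1 / r * (\<Sum>i<n. cost x i) \<le> real p"
  shows "(\<Sum>z\<leftarrow>selected x n. (ip d z v)\<^sup>2) \<le> 2 * c * ip d v v"
proof (cases "ip d v v = 0")
  case True
  then have "(ip d z v)\<^sup>2 \<le> 0" for z
    using ip_Cauchy_Schwarz[of d z v] by simp
  then have "(\<Sum>z\<leftarrow>selected x n. (ip d z v)\<^sup>2) \<le> (\<Sum>z\<leftarrow>selected x n. 0)"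
    by (intro sum_list_mono)
  then show ?thesis using True by simp
next
  case False
  define a where "a = 1 / sqrt (ip d v v)"
  define u where "u = (\<lambda>i. a * v i)"
  have vpos: "0 < ip d v v" using False ip_nonneg[of d v] by linarith
  have u: "ip d u u = 1"
  proof -
    have "ip d u u = a * a * ip d v v" by (simp add: u_def ip_scale_left ip_scale_right)
    then show ?thesis using vpos by (simp add: a_def)
  qed
  define M where "M = (\<Sum>z\<leftarrow>selected x n. (ip d z u)\<^sup>2)"
  have M0: "0 \<le> M" unfolding M_def by (intro sum_list_nonneg) auto
  have "(c + M) ^ p \<le> potential d c p r (selected x n)"
    unfolding M_def using c_pos r u by (intro top_eigenvalue_le_potential) auto
  also have "\<dots> \<le> r * c ^ p * exp (exp 1 / r * (\<Sum>i<n. cost x i))"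
    by (rule potential_selected)
  also have "\<dots> = c ^ p * exp (ln r + exp 1 / r * (\<Sum>i<n. cost x i))"
    using r by (simp add: exp_add)
  also have "\<dots> \<le> c ^ p * exp (real p)"
    using assms c_pos by (intro mult_left_mono) auto
  also have "\<dots> = (c * exp 1) ^ p"
    by (simp add: power_mult_distrib flip: exp_of_nat_mult)
  finally have "c + M \<le> c * exp 1"
    using p c_pos by (simp add: power_mono_iff add_nonneg_nonneg M0)
  also have "\<dots> \<le> c * 3" using c_pos exp_le by (intro mult_left_mono) auto
  finally have "M \<le> 2 * c" by simp
  moreover have "M = (\<Sum>z\<leftarrow>selected x n. (ip d z v)\<^sup>2) / ip d v v"
  proof -
    have "(\<lambda>z. (ip d z u)\<^sup>2) = (\<lambda>z. (ip d z v)\<^sup>2 * (1 / ip d v v))"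
    proof -
      have "ip d z u = a * ip d z v" for z by (simp add: u_def ip_scale_right)
      then show ?thesis using vpos by (simp add: a_def power_divide)
    qed
    then show ?thesis by (simp only: M_def sum_list_mult_const) simp
  qed
  ultimately show ?thesis using vpos by (simp add: field_simps)
qed

lemma exp_cost_le: "exp (cost x i) \<le> 1 + 2 * score (selected x i) (x i)"
proof -
  have "exp (cost x i) \<le> 1 + 2 * cost x i"
    by (intro exp_le_one_plus_double cost_nonneg) (simp add: cost_def)
  then show ?thesis by (simp add: cost_def)
qed

text \<open>Kept drifts are not centred, since acceptance depends on the point itself; the right
  side restores the full drift, which is. An accepted point has |drift| at most 1, so the quadratic
  bound applies. For a rejected one the left side is 1, and |drift| is at most the score because
  \<open>drift^2 <= score\<close> and score > 1.\<close>

lemma exp_gain_le: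
  "exp (gain x i) \<le> 1 + drift (selected x i) (x i) + score (selected x i) (x i)"
proof -
  let ?y = "drift (selected x i) (x i)" and ?w = "score (selected x i) (x i)"
  have y: "?y\<^sup>2 \<le> ?w" by (rule score_ge)
  show ?thesis
  proof (cases "?w \<le> 1")
    case True
    with y have "?y\<^sup>2 \<le> 1" by linarith
    then have "\<bar>?y\<bar> \<le> 1" by (simp add: abs_square_le_1)
    from exp_le_quadratic[OF this] show ?thesis using True y by (simp add: gain_def)
  next
    case False
    have "?y\<^sup>2 \<le> ?w\<^sup>2" using y False self_le_power[of ?w 2] by simp
    then have "\<bar>?y\<bar> \<le> ?w" using False by (simp add: abs_le_square_iff[symmetric])
    then show ?thesis using False by (simp add: gain_def)
  qed
qed

end

section \<open>Exponential moments along the sample\<close>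

lemma nn_integral_PiM_lessThan_Suc:
  assumes "prob_space D" and F: "F \<in> borel_measurable (\<Pi>\<^sub>M i\<in>{..<Suc n}. D)"
  shows "(\<integral>\<^sup>+x. F x \<partial>(\<Pi>\<^sub>M i\<in>{..<Suc n}. D))
    = (\<integral>\<^sup>+x. \<integral>\<^sup>+y. F (x(n := y)) \<partial>D \<partial>(\<Pi>\<^sub>M i\<in>{..<n}. D))"
proof -
  interpret D: prob_space D by fact
  interpret product_sigma_finite "\<lambda>_. D" by unfold_locales
  show ?thesis
    unfolding lessThan_Suc by (rule product_nn_integral_insert[OF _ _ F[unfolded lessThan_Suc]]) auto
qed

lemma measurable_upd_last:
  assumes "x \<in> space (\<Pi>\<^sub>M i\<in>{..<n}. D)"
  shows "(\<lambda>y. x(n := y)) \<in> D \<rightarrow>\<^sub>M (\<Pi>\<^sub>M i\<in>{..<Suc n}. D)"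
  unfolding lessThan_Suc using assms by (intro measurable_fun_upd[where J = "{..<n}"]) auto

text \<open>The last coordinate is integrated out first; \<open>dep\<close> lets the earlier terms
  leave the inner integral. Requiring \<open>step\<close> for every fixed past replaces conditional
  expectations and filtrations.\<close>

lemma nn_integral_exp_sum_le:
  fixes f :: "nat \<Rightarrow> (nat \<Rightarrow> 'a) \<Rightarrow> real"
  assumes D: "prob_space D"
    and dep: "\<And>i x y. (\<And>k. k \<le> i \<Longrightarrow> x k = y k) \<Longrightarrow> f i x = f i y"
    and meas: "\<And>i n. i < n \<Longrightarrow> f i \<in> borel_measurable (\<Pi>\<^sub>M i\<in>{..<n}. D)"
    and K: "0 \<le> K"
    and step: "\<And>n x. (\<integral>\<^sup>+y. ennreal (exp (f n (x(n := y)))) \<partial>D) \<le> ennreal K"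
  shows "(\<integral>\<^sup>+x. ennreal (exp (\<Sum>i<n. f i x)) \<partial>(\<Pi>\<^sub>M i\<in>{..<n}. D)) \<le> ennreal (K ^ n)"
proof (induction n)
  case 0
  interpret prob_space "\<Pi>\<^sub>M i\<in>{..<0::nat}. D" by (intro prob_space_PiM D)
  show ?case using emeasure_space_1 by simp
next
  case (Suc n)
  have [measurable]: "f i \<in> borel_measurable (\<Pi>\<^sub>M i\<in>{..<Suc n}. D)" if "i < Suc n" for i
    using meas[OF that] .
  let ?F = "\<lambda>x. ennreal (exp (\<Sum>i<Suc n. f i x))"
  have "(\<integral>\<^sup>+x. ?F x \<partial>(\<Pi>\<^sub>M i\<in>{..<Suc n}. D))
      = (\<integral>\<^sup>+x. \<integral>\<^sup>+y. ?F (x(n := y)) \<partial>D \<partial>(\<Pi>\<^sub>M i\<in>{..<n}. D))"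
    by (rule nn_integral_PiM_lessThan_Suc[OF D]) measurable
  also have "\<dots> \<le> (\<integral>\<^sup>+x. ennreal (exp (\<Sum>i<n. f i x)) * ennreal K \<partial>(\<Pi>\<^sub>M i\<in>{..<n}. D))"
  proof (rule nn_integral_mono)
    fix x assume x: "x \<in> space (\<Pi>\<^sub>M i\<in>{..<n}. D)"
    have eq: "?F (x(n := y)) = ennreal (exp (\<Sum>i<n. f i x)) * ennreal (exp (f n (x(n := y))))" for y
    proof -
      have "(\<Sum>i<n. f i (x(n := y))) = (\<Sum>i<n. f i x)"
        by (intro sum.cong refl dep) auto
      then show ?thesis by (simp add: exp_add ennreal_mult)
    qed
    from measurable_compose[OF measurable_upd_last[OF x] meas[of n "Suc n"]]
    have [measurable]: "(\<lambda>y. f n (x(n := y))) \<in> borel_measurable D" by simp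
    show "(\<integral>\<^sup>+y. ?F (x(n := y)) \<partial>D) \<le> ennreal (exp (\<Sum>i<n. f i x)) * ennreal K"
      unfolding eq by (subst nn_integral_cmult) (auto intro!: mult_left_mono step)
  qed
  also have "\<dots> = (\<integral>\<^sup>+x. ennreal (exp (\<Sum>i<n. f i x)) \<partial>(\<Pi>\<^sub>M i\<in>{..<n}. D)) * ennreal K"
    using meas by (intro nn_integral_multc) auto
  also have "\<dots> \<le> ennreal (K ^ n) * ennreal K"
    by (intro mult_right_mono Suc.IH) simp
  also have "\<dots> = ennreal (K ^ Suc n)"
    using K by (simp add: ennreal_mult mult.commute)
  finally show ?case .
qed

text \<open>Chernoff's bound with parameter 1, which suffices because costs and drifts are already
  scaled to unit size.\<close>

lemma exp_moment_tail:
  fixes g :: "'a \<Rightarrow> real"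
  assumes M: "prob_space M" and g[measurable]: "g \<in> borel_measurable M" and \<tau>: "0 < \<tau>"
    and moment: "(\<integral>\<^sup>+x. ennreal (exp (g x)) \<partial>M) \<le> ennreal (exp a)"
    and a: "a + ln (1 / \<tau>) \<le> w"
  shows "measure M {x \<in> space M. \<not> g x \<le> w} \<le> \<tau>"
proof -
  interpret prob_space M by fact
  have "emeasure M {x \<in> space M. \<not> g x \<le> w}
      \<le> emeasure M {x \<in> space M. 1 \<le> ennreal (exp (- w)) * ennreal (exp (g x))}"
  proof (rule emeasure_mono)
    have "1 \<le> ennreal (exp (- w)) * ennreal (exp (g x))" if "\<not> g x \<le> w" for x
      using that by (simp flip: ennreal_mult exp_add)
    then show "{x \<in> space M. \<not> g x \<le> w}
        \<subseteq> {x \<in> space M. 1 \<le> ennreal (exp (- w)) * ennreal (exp (g x))}" by blast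
  qed measurable
  also have "\<dots> \<le> ennreal (exp (- w)) * (\<integral>\<^sup>+x. ennreal (exp (g x)) * indicator (space M) x \<partial>M)"
    by (rule nn_integral_Markov_inequality) measurable
  also have "\<dots> \<le> ennreal (exp (- w)) * ennreal (exp a)"
    using moment by (intro mult_left_mono) (simp_all cong: nn_integral_cong)
  also have "\<dots> = ennreal (exp (a - w))"
    by (simp flip: ennreal_mult exp_add)
  also have "\<dots> \<le> ennreal \<tau>"
  proof (rule ennreal_leI)
    have "a - w \<le> ln \<tau>" using a \<tau> by (simp add: ln_div)
    then have "exp (a - w) \<le> exp (ln \<tau>)" by (simp only: exp_le_cancel_iff)
    then show "exp (a - w) \<le> \<tau>" using \<tau> by simp
  qed
  finally show ?thesis using \<tau> by (simp add: emeasure_eq_measure)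
qed

lemma nn_integral_le_of_integrable:
  fixes g h :: "'a \<Rightarrow> real"
  assumes "\<And>x. g x \<le> h x" "\<And>x. 0 \<le> g x" "integrable M h" "(\<integral>x. h x \<partial>M) \<le> K"
  shows "(\<integral>\<^sup>+x. ennreal (g x) \<partial>M) \<le> ennreal K"
proof -
  have "(\<integral>\<^sup>+x. ennreal (g x) \<partial>M) \<le> (\<integral>\<^sup>+x. ennreal (h x) \<partial>M)"
    using assms by (intro nn_integral_mono ennreal_leI)
  also have "\<dots> = ennreal (\<integral>x. h x \<partial>M)"
    using assms(3) order.trans[OF assms(2,1)] by (intro nn_integral_eq_integral) auto
  also have "\<dots> \<le> ennreal K" by (intro ennreal_leI assms)
  finally show ?thesis .
qed

section \<open>Centred distributions\<close>

definition centre :: "vect \<Rightarrow> vect \<Rightarrow> vect" where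
  "centre m x = (\<lambda>k. x k - m k)"

text \<open>In the application \<open>t\<close> is the trace and \<open>s2\<close> the spectral norm
  of the covariance; the selection sees the covariance only through these two numbers.\<close>

locale centred_distribution = prob_space D for D :: "vect measure" +
  fixes d :: nat and m :: vect and t s2 :: real
  assumes coord_measurable: "\<And>k. k < d \<Longrightarrow> (\<lambda>x. x k) \<in> borel_measurable D"
    and integrable_linear: "\<And>v. integrable D (\<lambda>x. ip d v (centre m x))"
    and expectation_linear: "\<And>v. (\<integral>x. ip d v (centre m x) \<partial>D) = 0"
    and integrable_square: "\<And>v. integrable D (\<lambda>x. (ip d v (centre m x))\<^sup>2)"
    and expectation_square: "\<And>v. (\<integral>x. (ip d v (centre m x))\<^sup>2 \<partial>D) \<le> s2 * ip d v v"
    and integrable_norm: "integrable D (\<lambda>x. ip d (centre m x) (centre m x))"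
    and expectation_norm: "(\<integral>x. ip d (centre m x) (centre m x) \<partial>D) = t"
begin

text \<open>This is \<open>tr (P Sigma) <= s2 tr P\<close> for the covariance, summed over the
  factors: each \<open><w, z>^2\<close> has mean at most \<open>s2 |w|^2\<close>.\<close>

lemma gram_expectation:
  assumes "gram d P"
  shows "integrable D (\<lambda>x. ip d (centre m x) (P (centre m x)))"
    and "(\<integral>x. ip d (centre m x) (P (centre m x)) \<partial>D) \<le> s2 * trace_op d P"
proof -
  obtain ws where ws: "\<And>u v. ip d u (P v) = (\<Sum>w\<leftarrow>ws. ip d w u * ip d w v)"
    using assms unfolding gram_def by blast
  have eq: "ip d (centre m x) (P (centre m x)) = (\<Sum>w\<leftarrow>ws. (ip d w (centre m x))\<^sup>2)" for x
    by (simp add: ws power2_eq_square)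
  have *: "integrable D (\<lambda>x. \<Sum>w\<leftarrow>ws. (ip d w (centre m x))\<^sup>2)
      \<and> (\<integral>x. (\<Sum>w\<leftarrow>ws. (ip d w (centre m x))\<^sup>2) \<partial>D) \<le> s2 * (\<Sum>w\<leftarrow>ws. ip d w w)"
  proof (induction ws)
    case (Cons w ws)
    then show ?case
      using integrable_square[of w] expectation_square[of w] by (simp add: distrib_left)
  qed simp
  show "integrable D (\<lambda>x. ip d (centre m x) (P (centre m x)))"
    unfolding eq using * by simp
  show "(\<integral>x. ip d (centre m x) (P (centre m x)) \<partial>D) \<le> s2 * trace_op d P"
    unfolding eq gram_trace[OF ws] using * by simp
qed

text \<open>The trace bound is used only for the excess of \<open>T^p\<close> over
  \<open>c^p I\<close>. The identity part contributes exactly \<open>c^p t = s2 r c^p\<close>; the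
  trace bound there would bring in d in place of r.\<close>

lemma power_form_expectation:
  assumes "0 \<le> c" "t = r * s2"
  shows "integrable D (\<lambda>x. power_form d c zs p (centre m x))"
    and "(\<integral>x. power_form d c zs p (centre m x) \<partial>D) \<le> s2 * potential d c p r zs"
proof -
  let ?N = "\<lambda>v i. (shifted_sum d c zs ^^ p) v i - c ^ p * v i"
  have eq: "power_form d c zs p v = ip d v (?N v) + c ^ p * ip d v v" for v
    by (simp add: ip_diff_right ip_scale_right)
  note N = gram_expectation[OF gram_excess[OF assms(1), where zs = zs and k = p and d = d]]
  show "integrable D (\<lambda>x. power_form d c zs p (centre m x))"
    unfolding eq using N(1) integrable_norm by simp
  have "(\<integral>x. power_form d c zs p (centre m x) \<partial>D)
      = (\<integral>x. ip d (centre m x) (?N (centre m x)) \<partial>D) + c ^ p * t"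
    unfolding eq using N(1) integrable_norm by (simp add: expectation_norm)
  also have "\<dots> \<le> s2 * trace_op d ?N + c ^ p * t" using N(2) by simp
  also have "\<dots> = s2 * potential d c p r zs"
    unfolding potential_def trace_excess assms(2) by (simp add: algebra_simps)
  finally show "(\<integral>x. power_form d c zs p (centre m x) \<partial>D) \<le> s2 * potential d c p r zs" .
qed

end

section \<open>The selected subsample is good with high probability\<close>

text \<open>The scales are set so that t/L, s2/thr and \<open>s2/Q^2\<close> all equal \<eta>; each
  of the three summands of the score then has mean at most \<eta> given the past.\<close>

locale random_selection = centred_distribution D d m t s2 + selection d p L thr Q b r
  for D d m t s2 p L thr Q b r +
  fixes \<eta> :: real
  assumes \<eta>: "0 < \<eta>" and t_eq: "t = r * s2" and L_eq: "L = t / \<eta>" and thr_eq: "thr = s2 / \<eta>"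
    and Q_eq: "Q\<^sup>2 = s2 / \<eta>"
begin

lemma s2_pos: "0 < s2"
  using thr \<eta> by (simp add: thr_eq zero_less_divide_iff)

lemma t_pos: "0 < t"
  using s2_pos r by (simp add: t_eq)

lemma drift_eq: "drift zs z = ip d (\<lambda>i. 1 / (Q * radius zs) * vsum zs i) z"
  unfolding ip_scale_left by (simp add: drift_def)

lemma drift_expectation:
  "integrable D (\<lambda>x. drift zs (centre m x))" "(\<integral>x. drift zs (centre m x) \<partial>D) = 0"
  unfolding drift_eq by (rule integrable_linear, rule expectation_linear)

lemma drift_square_expectation:
  "integrable D (\<lambda>x. (drift zs (centre m x))\<^sup>2)" "(\<integral>x. (drift zs (centre m x))\<^sup>2 \<partial>D) \<le> \<eta>"
proof -
  let ?u = "\<lambda>i. 1 / (Q * radius zs) * vsum zs i"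
  show "integrable D (\<lambda>x. (drift zs (centre m x))\<^sup>2)"
    unfolding drift_eq by (rule integrable_square)
  have "(\<integral>x. (drift zs (centre m x))\<^sup>2 \<partial>D) \<le> s2 * ip d ?u ?u"
    unfolding drift_eq by (rule expectation_square)
  also have "ip d ?u ?u = ip d (vsum zs) (vsum zs) / (Q\<^sup>2 * (radius zs)\<^sup>2)"
    unfolding ip_scale_left ip_scale_right by (simp add: power2_eq_square)
  also have "s2 * (ip d (vsum zs) (vsum zs) / (Q\<^sup>2 * (radius zs)\<^sup>2))
      = \<eta> * (ip d (vsum zs) (vsum zs) / (radius zs)\<^sup>2)"
    using s2_pos \<eta> unfolding Q_eq by (simp add: field_simps)
  also have "\<dots> \<le> \<eta> * 1"
  proof (intro mult_left_mono)
    have "ip d (vsum zs) (vsum zs) \<le> (radius zs)\<^sup>2"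
      by (simp add: radius_def)
    then show "ip d (vsum zs) (vsum zs) / (radius zs)\<^sup>2 \<le> 1"
      using radius_pos[of zs] by simp
  qed (use \<eta> in simp)
  finally show "(\<integral>x. (drift zs (centre m x))\<^sup>2 \<partial>D) \<le> \<eta>" by simp
qed

lemma score_expectation:
  "integrable D (\<lambda>x. score zs (centre m x))" "(\<integral>x. score zs (centre m x) \<partial>D) \<le> 3 * \<eta>"
proof -
  have c: "0 \<le> c" using c_pos by simp
  note pf = power_form_expectation[OF c t_eq, where zs = zs and p = p]
  show "integrable D (\<lambda>x. score zs (centre m x))"
    unfolding score_def using integrable_norm pf(1) drift_square_expectation(1) by simp
  have "(\<integral>x. score zs (centre m x) \<partial>D)
      = t / L + (\<integral>x. power_form d c zs p (centre m x) \<partial>D) / (thr * potential d c p r zs)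
        + (\<integral>x. (drift zs (centre m x))\<^sup>2 \<partial>D)"
    unfolding score_def using integrable_norm pf(1) drift_square_expectation(1)
    by (simp add: expectation_norm)
  also have "\<dots> \<le> \<eta> + \<eta> + \<eta>"
  proof (intro add_mono drift_square_expectation(2))
    show "t / L \<le> \<eta>" using t_pos \<eta> by (simp add: L_eq)
    have "(\<integral>x. power_form d c zs p (centre m x) \<partial>D) / (thr * potential d c p r zs)
        \<le> s2 * potential d c p r zs / (thr * potential d c p r zs)"
      using pf(2) thr potential_pos[of zs] by (intro divide_right_mono) auto
    also have "\<dots> = \<eta>" using s2_pos \<eta> potential_pos[of zs] by (simp add: thr_eq)
    finally show "(\<integral>x. power_form d c zs p (centre m x) \<partial>D) / (thr * potential d c p r zs) \<le> \<eta>" .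
  qed
  finally show "(\<integral>x. score zs (centre m x) \<partial>D) \<le> 3 * \<eta>" by simp
qed

abbreviation centred :: "(nat \<Rightarrow> vect) \<Rightarrow> nat \<Rightarrow> vect" where
  "centred x \<equiv> \<lambda>i. centre m (x i)"

lemma selected_upd: "selected (centred (x(n := y))) n = selected (centred x) n"
  by (rule selected_cong) auto

lemma cost_step:
  "(\<integral>\<^sup>+y. ennreal (exp (cost (centred (x(n := y))) n)) \<partial>D) \<le> ennreal (1 + 6 * \<eta>)"
proof (rule nn_integral_le_of_integrable)
  fix y
  show "exp (cost (centred (x(n := y))) n) \<le> 1 + 2 * score (selected (centred x) n) (centre m y)"
    using exp_cost_le[of "centred (x(n := y))" n] unfolding selected_upd by simp
qed (use score_expectation[of "selected (centred x) n"] in \<open>simp_all add: prob_space\<close>)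

lemma gain_step:
  "(\<integral>\<^sup>+y. ennreal (exp (gain (centred (x(n := y))) n)) \<partial>D) \<le> ennreal (1 + 3 * \<eta>)"
proof (rule nn_integral_le_of_integrable)
  fix y
  let ?zs = "selected (centred x) n"
  show "exp (gain (centred (x(n := y))) n) \<le> 1 + drift ?zs (centre m y) + score ?zs (centre m y)"
    using exp_gain_le[of "centred (x(n := y))" n] unfolding selected_upd by simp
qed (use score_expectation[of "selected (centred x) n"] drift_expectation[of "selected (centred x) n"]
     in \<open>simp_all add: prob_space\<close>)

definition measurable_vect :: "'b measure \<Rightarrow> ('b \<Rightarrow> vect) \<Rightarrow> bool" where
  "measurable_vect M v \<longleftrightarrow> (\<forall>k<d. (\<lambda>\<omega>. v \<omega> k) \<in> borel_measurable M)"

lemma measurable_ip: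
  "measurable_vect M u \<Longrightarrow> measurable_vect M v \<Longrightarrow> (\<lambda>\<omega>. ip d (u \<omega>) (v \<omega>)) \<in> borel_measurable M"
  unfolding measurable_vect_def ip_def by (intro borel_measurable_sum borel_measurable_times) auto

lemma measurable_const_vect: "measurable_vect M (\<lambda>_. v)"
  by (simp add: measurable_vect_def)

text \<open>Lists carry no sigma-algebra here. A list-valued map counts as measurable when what the
  score reads off is: the running sum, and the action of \<open>shifted_sum\<close> on any
  measurable vector.\<close>

definition measurable_state :: "'b measure \<Rightarrow> ('b \<Rightarrow> vect list) \<Rightarrow> bool" where
  "measurable_state M S \<longleftrightarrow> measurable_vect M (\<lambda>\<omega>. vsum (S \<omega>)) \<and>
    (\<forall>v. measurable_vect M v \<longrightarrow> measurable_vect M (\<lambda>\<omega>. shifted_sum d c (S \<omega>) (v \<omega>)))"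

lemma measurable_funpow:
  assumes "measurable_state M S" "measurable_vect M v"
  shows "measurable_vect M (\<lambda>\<omega>. (shifted_sum d c (S \<omega>) ^^ k) (v \<omega>))"
  using assms by (induction k) (auto simp: measurable_state_def)

lemma measurable_potential:
  assumes "measurable_state M S"
  shows "(\<lambda>\<omega>. potential d c p r (S \<omega>)) \<in> borel_measurable M"
proof -
  have "(\<lambda>\<omega>. (shifted_sum d c (S \<omega>) ^^ p) (unit_vec e) e) \<in> borel_measurable M" if "e < d" for e
    using measurable_funpow[OF assms measurable_const_vect[of M "unit_vec e"], of p] that
    by (simp add: measurable_vect_def)
  then show ?thesis unfolding potential_def trace_op_def
    by (intro borel_measurable_add borel_measurable_diff borel_measurable_sum) auto
qed

lemma measurable_drift:
  assumes "measurable_state M S" "measurable_vect M v"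
  shows "(\<lambda>\<omega>. drift (S \<omega>) (v \<omega>)) \<in> borel_measurable M"
proof -
  have vs: "measurable_vect M (\<lambda>\<omega>. vsum (S \<omega>))"
    using assms(1) by (simp add: measurable_state_def)
  note [measurable] = measurable_ip[OF vs vs] measurable_ip[OF vs assms(2)]
  show ?thesis unfolding drift_def radius_def by measurable
qed

lemma measurable_score:
  assumes "measurable_state M S" "measurable_vect M v"
  shows "(\<lambda>\<omega>. score (S \<omega>) (v \<omega>)) \<in> borel_measurable M"
proof -
  note [measurable] = measurable_ip[OF assms(2) assms(2)] measurable_drift[OF assms]
    measurable_ip[OF assms(2) measurable_funpow[OF assms, of p]] measurable_potential[OF assms(1)]
  show ?thesis unfolding score_def by measurable
qed

text \<open>The next state differs from the current one by a term switched on by the test on the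
  score, and that test is measurable because the current state is.\<close>

lemma measurable_selected:
  assumes "\<And>k. k < i \<Longrightarrow> measurable_vect M (\<lambda>\<omega>. X \<omega> k)"
  shows "measurable_state M (\<lambda>\<omega>. selected (X \<omega>) i)"
  using assms
proof (induction i)
  case 0
  show ?case
    unfolding measurable_state_def measurable_vect_def
    by (auto simp: shifted_sum_def rank_one_sum_def)
next
  case (Suc i)
  have S: "measurable_state M (\<lambda>\<omega>. selected (X \<omega>) i)" by (rule Suc.IH) (simp add: Suc.prems)
  have X: "measurable_vect M (\<lambda>\<omega>. X \<omega> i)" by (rule Suc.prems) simp
  note [measurable] = measurable_score[OF S X]
  have split_vsum: "vsum (selected (X \<omega>) (Suc i)) k
      = vsum (selected (X \<omega>) i) k + (if score (selected (X \<omega>) i) (X \<omega> i) \<le> 1 then X \<omega> i k else 0)" for \<omega> k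
    by simp
  have split_shifted: "shifted_sum d c (selected (X \<omega>) (Suc i)) v k
      = shifted_sum d c (selected (X \<omega>) i) v k
        + (if score (selected (X \<omega>) i) (X \<omega> i) \<le> 1 then ip d (X \<omega> i) v * X \<omega> i k else 0)" for \<omega> k v
    by (simp add: shifted_sum_Cons)
  show ?case
    unfolding measurable_state_def
  proof (intro conjI allI impI)
    show "measurable_vect M (\<lambda>\<omega>. vsum (selected (X \<omega>) (Suc i)))"
      unfolding measurable_vect_def split_vsum
    proof (intro allI impI)
      fix k assume k: "k < d"
      have [measurable]: "(\<lambda>\<omega>. X \<omega> i k) \<in> borel_measurable M"
        "(\<lambda>\<omega>. vsum (selected (X \<omega>) i) k) \<in> borel_measurable M"
        using X S k by (auto simp: measurable_vect_def measurable_state_def)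
      show "(\<lambda>\<omega>. vsum (selected (X \<omega>) i) k
          + (if score (selected (X \<omega>) i) (X \<omega> i) \<le> 1 then X \<omega> i k else 0)) \<in> borel_measurable M"
        by measurable
    qed
    fix v assume v: "measurable_vect M v"
    show "measurable_vect M (\<lambda>\<omega>. shifted_sum d c (selected (X \<omega>) (Suc i)) (v \<omega>))"
      unfolding measurable_vect_def split_shifted
    proof (intro allI impI)
      fix k assume k: "k < d"
      note [measurable] = measurable_ip[OF X v]
      have [measurable]: "(\<lambda>\<omega>. X \<omega> i k) \<in> borel_measurable M"
        "(\<lambda>\<omega>. shifted_sum d c (selected (X \<omega>) i) (v \<omega>) k) \<in> borel_measurable M"
        using X S v k by (auto simp: measurable_vect_def measurable_state_def)
      show "(\<lambda>\<omega>. shifted_sum d c (selected (X \<omega>) i) (v \<omega>) k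
          + (if score (selected (X \<omega>) i) (X \<omega> i) \<le> 1 then ip d (X \<omega> i) (v \<omega>) * X \<omega> i k else 0))
          \<in> borel_measurable M"
        by measurable
    qed
  qed
qed

lemma measurable_coordinate:
  assumes "i < n"
  shows "measurable_vect (\<Pi>\<^sub>M i\<in>{..<n}. D) (\<lambda>x. centred x i)"
  unfolding measurable_vect_def centre_def
proof (intro allI impI)
  fix k assume k: "k < d"
  have "(\<lambda>x. x i k) \<in> borel_measurable (\<Pi>\<^sub>M i\<in>{..<n}. D)"
    using assms by (intro measurable_compose[OF _ coord_measurable[OF k]] measurable_component_singleton) auto
  then show "(\<lambda>x. x i k - m k) \<in> borel_measurable (\<Pi>\<^sub>M i\<in>{..<n}. D)" by simp
qed

lemma measurable_cost_gain:
  assumes "i < n"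
  shows "(\<lambda>x. cost (centred x) i) \<in> borel_measurable (\<Pi>\<^sub>M i\<in>{..<n}. D)"
    and "(\<lambda>x. gain (centred x) i) \<in> borel_measurable (\<Pi>\<^sub>M i\<in>{..<n}. D)"
proof -
  have S: "measurable_state (\<Pi>\<^sub>M i\<in>{..<n}. D) (\<lambda>x. selected (centred x) i)"
    using assms by (intro measurable_selected measurable_coordinate) auto
  note X = measurable_coordinate[OF assms]
  note [measurable] = measurable_score[OF S X] measurable_drift[OF S X]
  show "(\<lambda>x. cost (centred x) i) \<in> borel_measurable (\<Pi>\<^sub>M i\<in>{..<n}. D)"
    unfolding cost_def by measurable
  show "(\<lambda>x. gain (centred x) i) \<in> borel_measurable (\<Pi>\<^sub>M i\<in>{..<n}. D)"
    unfolding gain_def by measurable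
qed

section \<open>Tail bounds for the total cost and the total gain\<close>

lemma cost_tail:
  assumes "0 < \<tau>" "6 * \<eta> * real n + ln (1 / \<tau>) \<le> w"
  shows "measure (\<Pi>\<^sub>M i\<in>{..<n}. D)
    {x \<in> space (\<Pi>\<^sub>M i\<in>{..<n}. D). \<not> (\<Sum>i<n. cost (centred x) i) \<le> w} \<le> \<tau>"
proof (rule exp_moment_tail)
  show "prob_space (\<Pi>\<^sub>M i\<in>{..<n}. D)" by (intro prob_space_PiM) unfold_locales
  show "(\<lambda>x. \<Sum>i<n. cost (centred x) i) \<in> borel_measurable (\<Pi>\<^sub>M i\<in>{..<n}. D)"
    by (intro borel_measurable_sum measurable_cost_gain) auto
  have "(\<integral>\<^sup>+x. ennreal (exp (\<Sum>i<n. cost (centred x) i)) \<partial>(\<Pi>\<^sub>M i\<in>{..<n}. D))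
      \<le> ennreal ((1 + 6 * \<eta>) ^ n)"
  proof (rule nn_integral_exp_sum_le)
    fix i :: nat and x y :: "nat \<Rightarrow> vect" assume eq: "\<And>k. k \<le> i \<Longrightarrow> x k = y k"
    have "selected (centred x) i = selected (centred y) i" by (rule selected_cong) (simp add: eq)
    then show "cost (centred x) i = cost (centred y) i" by (simp add: cost_def eq)
  next
    show "0 \<le> 1 + 6 * \<eta>" using \<eta> by simp
  qed (rule prob_space_axioms, erule measurable_cost_gain, rule cost_step)
  also have "\<dots> \<le> ennreal (exp (6 * \<eta> * real n))"
  proof (rule ennreal_leI)
    have "(1 + 6 * \<eta>) ^ n \<le> exp (6 * \<eta>) ^ n"
      using \<eta> exp_ge_add_one_self[of "6 * \<eta>"] by (intro power_mono) auto
    then show "(1 + 6 * \<eta>) ^ n \<le> exp (6 * \<eta> * real n)"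
      by (simp add: mult.commute flip: exp_of_nat_mult)
  qed
  finally show "(\<integral>\<^sup>+x. ennreal (exp (\<Sum>i<n. cost (centred x) i)) \<partial>(\<Pi>\<^sub>M i\<in>{..<n}. D))
      \<le> ennreal (exp (6 * \<eta> * real n))" .
qed (use assms in auto)

lemma gain_tail:
  assumes "0 < \<tau>" "3 * \<eta> * real n + ln (1 / \<tau>) \<le> w"
  shows "measure (\<Pi>\<^sub>M i\<in>{..<n}. D)
    {x \<in> space (\<Pi>\<^sub>M i\<in>{..<n}. D). \<not> (\<Sum>i<n. gain (centred x) i) \<le> w} \<le> \<tau>"
proof (rule exp_moment_tail)
  show "prob_space (\<Pi>\<^sub>M i\<in>{..<n}. D)" by (intro prob_space_PiM) unfold_locales
  show "(\<lambda>x. \<Sum>i<n. gain (centred x) i) \<in> borel_measurable (\<Pi>\<^sub>M i\<in>{..<n}. D)"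
    by (intro borel_measurable_sum measurable_cost_gain) auto
  have "(\<integral>\<^sup>+x. ennreal (exp (\<Sum>i<n. gain (centred x) i)) \<partial>(\<Pi>\<^sub>M i\<in>{..<n}. D))
      \<le> ennreal ((1 + 3 * \<eta>) ^ n)"
  proof (rule nn_integral_exp_sum_le)
    fix i :: nat and x y :: "nat \<Rightarrow> vect" assume eq: "\<And>k. k \<le> i \<Longrightarrow> x k = y k"
    have "selected (centred x) i = selected (centred y) i" by (rule selected_cong) (simp add: eq)
    then show "gain (centred x) i = gain (centred y) i" by (simp add: gain_def eq)
  next
    show "0 \<le> 1 + 3 * \<eta>" using \<eta> by simp
  qed (rule prob_space_axioms, erule measurable_cost_gain, rule gain_step)
  also have "\<dots> \<le> ennreal (exp (3 * \<eta> * real n))"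
  proof (rule ennreal_leI)
    have "(1 + 3 * \<eta>) ^ n \<le> exp (3 * \<eta>) ^ n"
      using \<eta> exp_ge_add_one_self[of "3 * \<eta>"] by (intro power_mono) auto
    then show "(1 + 3 * \<eta>) ^ n \<le> exp (3 * \<eta> * real n)"
      by (simp add: mult.commute flip: exp_of_nat_mult)
  qed
  finally show "(\<integral>\<^sup>+x. ennreal (exp (\<Sum>i<n. gain (centred x) i)) \<partial>(\<Pi>\<^sub>M i\<in>{..<n}. D))
      \<le> ennreal (exp (3 * \<eta> * real n))" .
qed (use assms in auto)

end

section \<open>Stability from moment bounds\<close>

lemma sum_mset_Cauchy_Schwarz:
  "(\<Sum>x\<in>#M. f x)\<^sup>2 \<le> real (size M) * (\<Sum>x\<in>#M. (f x)\<^sup>2)" for f :: "'a \<Rightarrow> real"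
proof -
  obtain xs where xs: "M = mset xs" using ex_mset by metis
  have "(\<Sum>x\<leftarrow>xs. 1 * f x)\<^sup>2 \<le> (\<Sum>x\<leftarrow>xs. 1\<^sup>2) * (\<Sum>x\<leftarrow>xs. (f x)\<^sup>2)"
    by (rule sum_list_Cauchy_Schwarz)
  moreover have "(\<Sum>x\<in>#M. g x) = (\<Sum>x\<leftarrow>xs. g x)" for g :: "'a \<Rightarrow> real"
    by (simp add: xs flip: sum_mset_sum_list mset_map)
  ultimately show ?thesis by (simp add: xs sum_list_triv)
qed

lemma sum_mset_real_nonneg: "(\<And>x. 0 \<le> f x) \<Longrightarrow> 0 \<le> (\<Sum>x\<in>#M. f x)" for f :: "'a \<Rightarrow> real"
  by (induction M) (auto intro: add_nonneg_nonneg)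

lemma sum_mset_mono_subset:
  fixes f :: "'a \<Rightarrow> real"
  assumes "M \<subseteq># N" "\<And>x. 0 \<le> f x"
  shows "(\<Sum>x\<in>#M. f x) \<le> (\<Sum>x\<in>#N. f x)"
proof -
  have "N = M + (N - M)" using assms(1) by simp
  then have "(\<Sum>x\<in>#N. f x) = (\<Sum>x\<in>#M. f x) + (\<Sum>x\<in>#N - M. f x)"
    by (metis image_mset_union sum_mset.union)
  moreover have "0 \<le> (\<Sum>x\<in>#N - M. f x)" by (intro sum_mset_real_nonneg assms)
  ultimately show ?thesis by simp
qed

section \<open>Quadratic forms and the spectral norm of symmetric matrices\<close>

lemma ip_sum_mset_right: "ip d u (\<lambda>i. \<Sum>x\<in>#M. g x i) = (\<Sum>x\<in>#M. ip d u (g x))"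
  by (induction M) (simp_all add: ip_add_right)

lemma ip_mat_vec_sym:
  assumes "\<And>i j. i < d \<Longrightarrow> j < d \<Longrightarrow> A i j = A j i"
  shows "ip d u (mat_vec d A v) = ip d (mat_vec d A u) v"
proof -
  have "ip d u (mat_vec d A v) = (\<Sum>i<d. \<Sum>j<d. u i * (A i j * v j))"
    by (simp add: ip_def mat_vec_def sum_distrib_left)
  also have "\<dots> = (\<Sum>j<d. \<Sum>i<d. A j i * u i * v j)"
    by (subst sum.swap) (auto intro!: sum.cong simp: assms)
  also have "\<dots> = ip d (mat_vec d A u) v"
    by (simp add: ip_def mat_vec_def sum_distrib_right)
  finally show ?thesis .
qed

lemma mat_vec_add: "mat_vec d A (\<lambda>i. u i + v i) = (\<lambda>i. mat_vec d A u i + mat_vec d A v i)"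
  by (simp add: mat_vec_def algebra_simps sum.distrib)

lemma mat_vec_scale: "mat_vec d A (\<lambda>i. s * v i) = (\<lambda>i. s * mat_vec d A v i)"
  by (simp add: mat_vec_def sum_distrib_left mult_ac)

text \<open>For a symmetric matrix the quadratic form controls the operator norm: polarisation
  bounds \<open><u, A v>\<close>, and u is taken parallel to \<open>A v\<close>.\<close>

lemma vnorm_mat_vec_le:
  assumes sym: "\<And>i j. i < d \<Longrightarrow> j < d \<Longrightarrow> A i j = A j i"
    and form: "\<And>v. \<bar>ip d v (mat_vec d A v)\<bar> \<le> K * ip d v v"
  shows "vnorm d (mat_vec d A v) \<le> K * vnorm d v"
proof -
  define w where "w = mat_vec d A v"
  have polar: "2 * ip d u (mat_vec d A v) \<le> K * (ip d u u + ip d v v)" for u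
  proof -
    let ?Q = "\<lambda>v. ip d v (mat_vec d A v)"
    let ?m = "\<lambda>i. -1 * v i"
    have "ip d v (mat_vec d A u) = ip d u (mat_vec d A v)"
      using ip_mat_vec_sym[where d = d and A = A and u = v and v = u, OF sym] by (simp add: ip_commute)
    then have "4 * ip d u (mat_vec d A v) = ?Q (\<lambda>i. u i + v i) - ?Q (\<lambda>i. u i + ?m i)"
      unfolding mat_vec_add mat_vec_scale ip_add_left ip_add_right ip_scale_left ip_scale_right
      by simp
    also have "\<dots> \<le> K * ip d (\<lambda>i. u i + v i) (\<lambda>i. u i + v i)
        + K * ip d (\<lambda>i. u i + ?m i) (\<lambda>i. u i + ?m i)"
      using form[of "\<lambda>i. u i + v i"] form[of "\<lambda>i. u i + ?m i"] by linarith
    also have "\<dots> = 2 * (K * (ip d u u + ip d v v))"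
      unfolding ip_add_left ip_add_right ip_scale_left ip_scale_right
      by (simp add: algebra_simps ip_commute[of d v u])
    finally show ?thesis by simp
  qed
  have "ip d w w = ip d (mat_vec d A w) v"
    unfolding w_def by (rule ip_mat_vec_sym[OF sym])
  then have w0: "ip d w w = 0" if "ip d v v = 0"
    using ip_Cauchy_Schwarz[of d "mat_vec d A w" v] that by simp
  show ?thesis
  proof (cases "ip d w w = 0 \<or> ip d v v = 0")
    case True
    have "0 \<le> K * ip d v v" using form[of v] by linarith
    then have "0 \<le> K * vnorm d v"
      by (cases "ip d v v = 0") (simp_all add: vnorm_eq zero_le_mult_iff)
    then show ?thesis using True w0 by (auto simp: vnorm_eq w_def[symmetric])
  next
    case False
    define a where "a = vnorm d v" define b where "b = vnorm d w"
    have a: "0 < a" "ip d v v = a\<^sup>2" and b: "0 < b" "ip d w w = b\<^sup>2"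
      using False ip_nonneg[of d v] ip_nonneg[of d w] unfolding a_def b_def vnorm_eq
      by (simp_all add: order_less_le)
    have e: "a / b * b\<^sup>2 = a * b" "a / b * (a * b) = a\<^sup>2"
      using b(1) by (simp_all add: power2_eq_square)
    \<comment> \<open>The vector w is rescaled to the length of v, which balances the two squares on
      the right.\<close>
    have "2 * (a * b) \<le> K * (a\<^sup>2 + a\<^sup>2)"
      using polar[of "\<lambda>i. a / b * w i"]
      unfolding w_def[symmetric] ip_scale_left ip_scale_right a(2) b(2) e .
    then have "a * b \<le> a * (K * a)" by (simp add: power2_eq_square algebra_simps)
    then have "b \<le> K * a" using a(1) by simp
    then show ?thesis by (simp add: a_def b_def w_def)
  qed
qed

lemma zero_vect_in_unit_ball: "(\<lambda>i\<in>{..<d}. 0) \<in> {v \<in> Rd d. vnorm d v \<le> 1}"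
  by (simp add: Rd_def vnorm_eq ip_def)

lemma spectral_norm_le:
  assumes sym: "\<And>i j. i < d \<Longrightarrow> j < d \<Longrightarrow> A i j = A j i"
    and form: "\<And>v. \<bar>ip d v (mat_vec d A v)\<bar> \<le> K * ip d v v" and K: "0 \<le> K"
  shows "spectral_norm d A \<le> K"
  unfolding spectral_norm_def
proof (rule cSUP_least)
  show "{v \<in> Rd d. vnorm d v \<le> 1} \<noteq> {}" using zero_vect_in_unit_ball by blast
  fix v assume "v \<in> {v \<in> Rd d. vnorm d v \<le> 1}"
  then have "K * vnorm d v \<le> K * 1" using K by (intro mult_left_mono) auto
  then show "vnorm d (mat_vec d A v) \<le> K"
    using vnorm_mat_vec_le[of d A K v, OF sym form] by simp
qed

text \<open>The number \<open>K\<close> ensures that the supremum defining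
  \<open>spectral_norm\<close> is over a bounded set. The test vector is v normalised and made
  extensional, so that it lies in \<open>Rd d\<close>.\<close>

lemma form_le_spectral_norm:
  assumes sym: "\<And>i j. i < d \<Longrightarrow> j < d \<Longrightarrow> A i j = A j i"
    and form: "\<And>v. \<bar>ip d v (mat_vec d A v)\<bar> \<le> K * ip d v v" and K: "0 \<le> K"
  shows "ip d v (mat_vec d A v) \<le> spectral_norm d A * ip d v v"
proof (cases "ip d v v = 0")
  case True
  then show ?thesis using form[of v] by simp
next
  case False
  define a where "a = vnorm d v"
  have a: "0 < a" "ip d v v = a\<^sup>2"
    using False ip_nonneg[of d v] unfolding a_def vnorm_eq by (simp_all add: order_less_le)
  define u where "u = (\<lambda>i\<in>{..<d}. 1 / a * v i)"
  have mv: "mat_vec d A u = (\<lambda>i. 1 / a * mat_vec d A v i)"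
    unfolding mat_vec_scale[symmetric] by (simp add: mat_vec_def u_def)
  have "ip d u u = ip d (\<lambda>i. 1 / a * v i) (\<lambda>i. 1 / a * v i)" by (simp add: ip_def u_def)
  also have "\<dots> = 1" unfolding ip_scale_left ip_scale_right a(2) using a(1) by (simp add: power2_eq_square)
  finally have "vnorm d u = 1" by (simp add: vnorm_eq)
  then have u: "u \<in> {v \<in> Rd d. vnorm d v \<le> 1}" by (simp add: Rd_def u_def)
  have bdd: "bdd_above ((\<lambda>v. vnorm d (mat_vec d A v)) ` {v \<in> Rd d. vnorm d v \<le> 1})"
  proof (rule bdd_aboveI2)
    fix v assume "v \<in> {v \<in> Rd d. vnorm d v \<le> 1}"
    then have "K * vnorm d v \<le> K * 1" using K by (intro mult_left_mono) auto
    then show "vnorm d (mat_vec d A v) \<le> K"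
      using vnorm_mat_vec_le[of d A K v, OF sym form] by simp
  qed
  have "vnorm d (mat_vec d A u) \<le> spectral_norm d A"
    unfolding spectral_norm_def by (rule cSUP_upper[OF u bdd])
  moreover have "vnorm d (mat_vec d A u) = vnorm d (mat_vec d A v) / a"
    using a(1) unfolding mv vnorm_eq ip_scale_left ip_scale_right
    by (simp add: real_sqrt_divide flip: power2_eq_square)
  ultimately have "vnorm d (mat_vec d A v) \<le> spectral_norm d A * a"
    using a(1) by (simp add: field_simps)
  then have "a * vnorm d (mat_vec d A v) \<le> a * (spectral_norm d A * a)"
    using a(1) by simp
  moreover have "ip d v (mat_vec d A v) \<le> a * vnorm d (mat_vec d A v)"
    using ip_le_vnorm[of d v "mat_vec d A v"] by (simp add: a_def)
  ultimately show ?thesis by (simp add: a(2) power2_eq_square algebra_simps)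
qed

lemma ip_mat_vec_emp_second_moment:
  "ip d v (mat_vec d (\<lambda>i j. emp_second_moment m S i j - (if i = j then s else 0)) v)
    = (\<Sum>x\<in>#S. (ip d (centre m x) v)\<^sup>2) / real (size S) - s * ip d v v"
proof -
  have sq: "(ip d (centre m x) v)\<^sup>2 = (\<Sum>i<d. \<Sum>j<d. v i * v j * ((x i - m i) * (x j - m j)))" for x
    by (simp add: ip_def centre_def power2_eq_square sum_product mult_ac)
  have "ip d v (mat_vec d (\<lambda>i j. emp_second_moment m S i j - (if i = j then s else 0)) v)
      = (\<Sum>i<d. \<Sum>j<d. v i * v j * emp_second_moment m S i j)
        - (\<Sum>i<d. \<Sum>j<d. if i = j then s * v i * v j else 0)"
    unfolding ip_def mat_vec_def sum_distrib_left sum_subtractf[symmetric]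
    by (intro sum.cong refl) (auto simp: algebra_simps)
  also have "(\<Sum>i<d. \<Sum>j<d. if i = j then s * v i * v j else 0) = s * ip d v v"
    by (simp add: ip_def sum_distrib_left mult.assoc)
  also have "(\<Sum>i<d. \<Sum>j<d. v i * v j * emp_second_moment m S i j)
      = (\<Sum>i<d. \<Sum>j<d. v i * v j * (\<Sum>x\<in>#S. (x i - m i) * (x j - m j))) / real (size S)"
    by (simp add: emp_second_moment_def sum_divide_distrib)
  also have "(\<Sum>i<d. \<Sum>j<d. v i * v j * (\<Sum>x\<in>#S. (x i - m i) * (x j - m j)))
      = (\<Sum>x\<in>#S. (ip d (centre m x) v)\<^sup>2)"
    by (induction S) (simp_all add: sq distrib_left sum.distrib)
  finally show ?thesis .
qed

text \<open>Since \<delta> is at least 4 sqrt(\<alpha> \<Lambda>)/\<sigma>, the tolerance in the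
  second stability condition exceeds both the second moments and \<open>\<sigma>^2\<close>. Only an
  upper bound on second moments is then required, and it passes to subsets. For the means, the sum u
  of the removed points is paired with itself: Cauchy-Schwarz over at most \<alpha> n points gives
  \<open>|u|^4 <= \<alpha> n^2 \<Lambda> |u|^2\<close>.\<close>

lemma stable_of_moments:
  assumes \<alpha>: "0 < \<alpha>" "\<alpha> < 1 / 2" and \<sigma>: "0 < \<sigma>" "\<sigma>\<^sup>2 \<le> \<Lambda>" and n: "0 < n"
    and size: "n / 2 \<le> real (size S)" "real (size S) \<le> n"
    and second: "\<And>v. (\<Sum>x\<in>#S. (ip d (centre m x) v)\<^sup>2) \<le> n * \<Lambda> * ip d v v"
    and first: "vnorm d (\<lambda>i. \<Sum>x\<in>#S. centre m x i) \<le> n * D0"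
  shows "stable d \<alpha> (4 * (D0 + sqrt (\<alpha> * \<Lambda>)) / \<sigma>) m \<sigma> S"
proof -
  define \<Delta> where "\<Delta> = 4 * (D0 + sqrt (\<alpha> * \<Lambda>))"
  have \<Lambda>: "0 < \<Lambda>" using \<sigma> by (meson less_le_trans zero_less_power)
  have "0 \<le> n * D0" using first vnorm_nonneg[of d "\<lambda>i. \<Sum>x\<in>#S. centre m x i"] by linarith
  then have D0: "0 \<le> D0" using n by (simp add: zero_le_mult_iff)
  have sq: "0 \<le> sqrt (\<alpha> * \<Lambda>)" using \<alpha> \<Lambda> by simp
  have \<Delta>4: "4 * sqrt (\<alpha> * \<Lambda>) \<le> \<Delta>" using D0 by (simp add: \<Delta>_def)
  then have "(4 * sqrt (\<alpha> * \<Lambda>))\<^sup>2 \<le> \<Delta>\<^sup>2" using sq by (intro power_mono) auto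
  then have \<Delta>2: "16 * (\<alpha> * \<Lambda>) \<le> \<Delta>\<^sup>2" using \<alpha> \<Lambda> by (simp add: power_mult_distrib)
  have S0: "S \<noteq> {#}" using size n by auto
  have le: "\<alpha> \<le> \<Delta> / \<sigma>"
  proof -
    have "\<alpha> * \<sigma> = sqrt ((\<alpha> * \<sigma>)\<^sup>2)" using \<alpha> \<sigma> by simp
    also have "\<dots> \<le> sqrt (\<alpha> * \<Lambda>)"
    proof (rule real_sqrt_le_mono)
      have "\<alpha> * \<alpha> * \<sigma>\<^sup>2 \<le> \<alpha> * 1 * \<Lambda>"
        using \<alpha> \<sigma> \<Lambda> by (intro mult_mono) auto
      then show "(\<alpha> * \<sigma>)\<^sup>2 \<le> \<alpha> * \<Lambda>" by (simp add: power2_eq_square mult_ac)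
    qed
    also have "\<dots> \<le> \<Delta>" using \<Delta>4 sq by linarith
    finally show ?thesis using \<sigma> by (simp add: field_simps)
  qed
  have main: "vnorm d (\<lambda>i. emp_mean S' i - m i) \<le> \<Delta>
      \<and> spectral_norm d (\<lambda>i j. emp_second_moment m S' i j - (if i = j then \<sigma>\<^sup>2 else 0)) \<le> \<Delta>\<^sup>2 / \<alpha>"
    if S': "S' \<subseteq># S" and big: "(1 - \<alpha>) * real (size S) \<le> real (size S')" for S'
  proof
    let ?N = "real (size S')" and ?R = "S - S'"
    \<comment> \<open>Both 1 - \<alpha> >= 1/2 and |S| >= n/2 enter here; the factor 4 comes from
      this.\<close>
    have "1 / 2 * (n / 2) \<le> (1 - \<alpha>) * real (size S)"
      using \<alpha> size n by (intro mult_mono) auto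
    then have N4: "n / 4 \<le> ?N" using big by simp
    then have N: "0 < ?N" using n by linarith
    have split: "S = S' + ?R" using S' by simp
    then have "real (size S) = ?N + real (size ?R)" by (metis of_nat_add size_union)
    then have "real (size ?R) \<le> \<alpha> * real (size S)" using big by (simp add: algebra_simps)
    also have "\<dots> \<le> \<alpha> * n" using \<alpha> size by (intro mult_left_mono) auto
    finally have R: "real (size ?R) \<le> \<alpha> * n" .

    define u where "u = (\<lambda>i. \<Sum>x\<in>#?R. centre m x i)"
    have "(ip d u u)\<^sup>2 = (\<Sum>x\<in>#?R. ip d u (centre m x))\<^sup>2"
      by (subst (2) u_def) (simp add: ip_sum_mset_right)
    also have "\<dots> \<le> real (size ?R) * (\<Sum>x\<in>#?R. (ip d u (centre m x))\<^sup>2)"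
      by (rule sum_mset_Cauchy_Schwarz)
    also have "\<dots> \<le> (\<alpha> * n) * (\<Sum>x\<in>#S. (ip d u (centre m x))\<^sup>2)"
      using R \<alpha> n by (intro mult_mono sum_mset_mono_subset sum_mset_real_nonneg) auto
    also have "\<dots> \<le> (\<alpha> * n) * (n * \<Lambda> * ip d u u)"
    proof (intro mult_left_mono)
      have "(\<lambda>x. (ip d u (centre m x))\<^sup>2) = (\<lambda>x. (ip d (centre m x) u)\<^sup>2)"
        by (intro ext arg_cong[where f = "\<lambda>r. r\<^sup>2"] ip_commute)
      then show "(\<Sum>x\<in>#S. (ip d u (centre m x))\<^sup>2) \<le> n * \<Lambda> * ip d u u"
        using second[of u] by (simp only:)
    qed (use \<alpha> n in simp)
    finally have "ip d u u * ip d u u \<le> (\<alpha> * n * (n * \<Lambda>)) * ip d u u"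
      by (simp add: power2_eq_square mult_ac)
    then have "ip d u u \<le> \<alpha> * n * (n * \<Lambda>)"
      using ip_nonneg[of d u] \<alpha> n \<Lambda> by (cases "ip d u u = 0") (auto simp: order_less_le)
    then have "vnorm d u \<le> sqrt (n\<^sup>2 * (\<alpha> * \<Lambda>))"
      unfolding vnorm_eq by (intro real_sqrt_le_mono) (simp add: power2_eq_square mult_ac)
    also have "\<dots> = n * sqrt (\<alpha> * \<Lambda>)" using n by (simp add: real_sqrt_mult)
    finally have u: "vnorm d u \<le> n * sqrt (\<alpha> * \<Lambda>)" .

    define s where "s = (\<lambda>i. \<Sum>x\<in>#S. centre m x i)"
    have mean_eq: "emp_mean S' i - m i = 1 / ?N * (s i + - u i)" for i
    proof -
      have "s i = (\<Sum>x\<in>#S'. centre m x i) + u i"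
        unfolding s_def u_def by (subst split) simp
      moreover have "(\<Sum>x\<in>#S'. centre m x i) = (\<Sum>x\<in>#S'. x i) - ?N * m i"
        by (induction S') (simp_all add: centre_def algebra_simps)
      ultimately have "(\<Sum>x\<in>#S'. x i) = s i - u i + ?N * m i" by linarith
      then show ?thesis using N by (auto simp: emp_mean_def add_divide_distrib)
    qed
    have "vnorm d (\<lambda>i. emp_mean S' i - m i) = 1 / ?N * vnorm d (\<lambda>i. s i + - u i)"
      unfolding mean_eq vnorm_def using N by (intro L2_set_right_distrib[symmetric]) simp
    also have "\<dots> \<le> 1 / ?N * (vnorm d s + vnorm d u)"
    proof -
      have "vnorm d (\<lambda>i. s i + - u i) \<le> vnorm d s + vnorm d (\<lambda>i. - u i)"
        unfolding vnorm_def by (rule L2_set_triangle_ineq)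
      also have "vnorm d (\<lambda>i. - u i) = vnorm d u" by (simp add: vnorm_def L2_set_def)
      finally show ?thesis using N by (intro mult_left_mono) auto
    qed
    also have "\<dots> \<le> 1 / ?N * (n * D0 + n * sqrt (\<alpha> * \<Lambda>))"
      using first u N unfolding s_def[symmetric] by (intro mult_left_mono add_mono) auto
    also have "\<dots> = n / ?N * (D0 + sqrt (\<alpha> * \<Lambda>))" by (simp add: algebra_simps)
    also have "\<dots> \<le> 4 * (D0 + sqrt (\<alpha> * \<Lambda>))"
      using N4 N D0 sq by (intro mult_right_mono) (auto simp: field_simps)
    finally show "vnorm d (\<lambda>i. emp_mean S' i - m i) \<le> \<Delta>" by (simp add: \<Delta>_def)

    have "spectral_norm d (\<lambda>i j. emp_second_moment m S' i j - (if i = j then \<sigma>\<^sup>2 else 0)) \<le> 4 * \<Lambda>"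
    proof (rule spectral_norm_le)
      fix v
      let ?X = "(\<Sum>x\<in>#S'. (ip d (centre m x) v)\<^sup>2)"
      have "?X \<le> (\<Sum>x\<in>#S. (ip d (centre m x) v)\<^sup>2)"
        using S' by (rule sum_mset_mono_subset) simp
      also have "\<dots> \<le> n * \<Lambda> * ip d v v" by (rule second)
      also have "\<dots> \<le> (4 * ?N) * \<Lambda> * ip d v v"
        using N4 \<Lambda> by (intro mult_right_mono) auto
      finally have "?X / ?N \<le> 4 * \<Lambda> * ip d v v" using N by (simp add: field_simps)
      moreover have "0 \<le> ?X / ?N" using N by (intro divide_nonneg_pos sum_mset_real_nonneg) auto
      moreover have "\<sigma>\<^sup>2 * ip d v v \<le> 4 * \<Lambda> * ip d v v"
        using \<sigma> \<Lambda> by (intro mult_right_mono) auto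
      moreover have "0 \<le> \<sigma>\<^sup>2 * ip d v v" by simp
      ultimately show "\<bar>ip d v (mat_vec d
          (\<lambda>i j. emp_second_moment m S' i j - (if i = j then \<sigma>\<^sup>2 else 0)) v)\<bar> \<le> 4 * \<Lambda> * ip d v v"
        unfolding ip_mat_vec_emp_second_moment by linarith
    qed (use \<Lambda> in \<open>auto simp: emp_second_moment_def mult.commute\<close>)
    also have "4 * \<Lambda> \<le> \<Delta>\<^sup>2 / \<alpha>"
    proof -
      have "0 < \<alpha> * \<Lambda>" using \<alpha> \<Lambda> by simp
      then have "4 * \<Lambda> * \<alpha> \<le> \<Delta>\<^sup>2" using \<Delta>2 by (simp add: mult_ac)
      then show ?thesis using \<alpha> by (simp add: pos_le_divide_eq)
    qed
    finally show "spectral_norm d (\<lambda>i j. emp_second_moment m S' i j - (if i = j then \<sigma>\<^sup>2 else 0))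
        \<le> \<Delta>\<^sup>2 / \<alpha>" .
  qed
  have "\<sigma> * (\<Delta> / \<sigma>) = \<Delta>" "\<sigma>\<^sup>2 * (\<Delta> / \<sigma>)\<^sup>2 / \<alpha> = \<Delta>\<^sup>2 / \<alpha>"
    using \<sigma> by (simp_all add: power_divide)
  then show ?thesis
    unfolding stable_def \<Delta>_def[symmetric] using main \<alpha> le S0 by simp
qed

section \<open>Mean and covariance of a distribution\<close>

lemma covariance_sym: "covariance d D i j = covariance d D j i"
  by (simp add: covariance_def mult.commute)

lemma ip_mat_vec: "ip d v (mat_vec d A v) = (\<Sum>i<d. \<Sum>j<d. v i * v j * A i j)"
  by (simp add: ip_def mat_vec_def sum_distrib_left mult_ac)

text \<open>The mean of \<open><v, z>^2\<close> is the quadratic form of \<Sigma>, which is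
  therefore nonnegative and bounded by the trace. If the spectral norm vanished, so would this form,
  and with it every entry.\<close>

lemma centred_distribution_covariance:
  assumes dist: "distribution_on_Rd d D" and fin: "finite_covariance d D"
  defines "m \<equiv> mean_vec d D" and "\<Sigma> \<equiv> covariance d D"
  shows "centred_distribution D d m (mtrace d \<Sigma>) (spectral_norm d \<Sigma>)"
    and "spectral_norm d \<Sigma> \<le> mtrace d \<Sigma>"
    and "\<exists>i<d. \<exists>j<d. \<Sigma> i j \<noteq> 0 \<Longrightarrow> 0 < spectral_norm d \<Sigma>"
proof -
  interpret prob_space D using dist by (simp add: distribution_on_Rd_def)
  have meas[measurable]: "(\<lambda>x. x k) \<in> borel_measurable D" if "k < d" for k
  proof -
    have sets: "sets D = sets (borel_Rd d)" using dist by (simp add: distribution_on_Rd_def)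
    show ?thesis
      using that by (subst measurable_cong_sets[OF sets refl]) (intro measurable_component_singleton, simp)
  qed
  have int2: "integrable D (\<lambda>x. (x k)\<^sup>2)" if "k < d" for k
    using fin that by (simp add: finite_covariance_def)
  have int1: "integrable D (\<lambda>x. x k)" if "k < d" for k
    using square_integrable_imp_integrable[OF meas[OF that] int2[OF that]] .
  have mean: "m k = (\<integral>x. x k \<partial>D)" if "k < d" for k
    using that by (simp add: m_def mean_vec_def)
  have c1: "integrable D (\<lambda>x. centre m x k)" "(\<integral>x. centre m x k \<partial>D) = 0" if "k < d" for k
    using int1[OF that] by (simp_all add: centre_def mean[OF that] prob_space)
  have meas_c[measurable]: "(\<lambda>x. centre m x k) \<in> borel_measurable D" if "k < d" for k
    using meas[OF that] by (simp add: centre_def)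
  have c2: "integrable D (\<lambda>x. (centre m x k)\<^sup>2)" if "k < d" for k
    using int1[OF that] int2[OF that] by (simp add: centre_def power2_diff)
  have c11: "integrable D (\<lambda>x. centre m x i * centre m x j)" if "i < d" "j < d" for i j
  proof (rule Bochner_Integration.integrable_bound)
    show "integrable D (\<lambda>x. (centre m x i)\<^sup>2 + (centre m x j)\<^sup>2)"
      using c2 that by simp
    show "(\<lambda>x. centre m x i * centre m x j) \<in> borel_measurable D" using that by simp
    have "\<bar>a * b\<bar> \<le> a\<^sup>2 + b\<^sup>2" for a b :: real
    proof -
      have "2 * (\<bar>a\<bar> * \<bar>b\<bar>) \<le> \<bar>a\<bar>\<^sup>2 + \<bar>b\<bar>\<^sup>2"
        using sum_squares_bound[of "\<bar>a\<bar>" "\<bar>b\<bar>"] by simp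
      moreover have "0 \<le> \<bar>a\<bar> * \<bar>b\<bar>" by simp
      ultimately show ?thesis unfolding abs_mult power2_abs by linarith
    qed
    then show "AE x in D. norm (centre m x i * centre m x j)
        \<le> norm ((centre m x i)\<^sup>2 + (centre m x j)\<^sup>2)"
      by (auto simp: abs_of_nonneg)
  qed
  have cov: "\<Sigma> i j = (\<integral>x. centre m x i * centre m x j \<partial>D)" for i j
    by (simp add: \<Sigma>_def covariance_def centre_def m_def)
  have sq: "(ip d v (centre m x))\<^sup>2 = (\<Sum>i<d. \<Sum>j<d. v i * v j * (centre m x i * centre m x j))" for v x
    by (simp add: ip_def power2_eq_square sum_product mult_ac)
  have int_sq: "integrable D (\<lambda>x. (ip d v (centre m x))\<^sup>2)" for v
    unfolding sq using c11 by (intro Bochner_Integration.integrable_sum) auto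
  have E_sq: "(\<integral>x. (ip d v (centre m x))\<^sup>2 \<partial>D) = ip d v (mat_vec d \<Sigma> v)" for v
    unfolding sq ip_mat_vec cov using c11
    by (subst Bochner_Integration.integral_sum; (intro Bochner_Integration.integrable_sum)?; simp)+
  have int_norm: "integrable D (\<lambda>x. ip d (centre m x) (centre m x))"
    unfolding ip_def using c11 by (intro Bochner_Integration.integrable_sum) auto
  have E_norm: "(\<integral>x. ip d (centre m x) (centre m x) \<partial>D) = mtrace d \<Sigma>"
    unfolding ip_def mtrace_def cov using c11 by (subst Bochner_Integration.integral_sum) auto
  have sym: "\<Sigma> i j = \<Sigma> j i" for i j by (simp add: \<Sigma>_def covariance_sym)
  have form_nonneg: "0 \<le> ip d v (mat_vec d \<Sigma> v)" for v
    unfolding E_sq[symmetric] by simp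
  have form_le: "ip d v (mat_vec d \<Sigma> v) \<le> mtrace d \<Sigma> * ip d v v" for v
  proof -
    have "(\<integral>x. (ip d v (centre m x))\<^sup>2 \<partial>D) \<le> (\<integral>x. ip d v v * ip d (centre m x) (centre m x) \<partial>D)"
      using int_sq int_norm by (intro integral_mono ip_Cauchy_Schwarz) auto
    then show ?thesis by (simp add: E_sq E_norm mult.commute)
  qed
  have form: "\<bar>ip d v (mat_vec d \<Sigma> v)\<bar> \<le> mtrace d \<Sigma> * ip d v v" for v
    using form_nonneg[of v] form_le[of v] by simp
  have tr: "0 \<le> mtrace d \<Sigma>" unfolding E_norm[symmetric] by simp
  show "centred_distribution D d m (mtrace d \<Sigma>) (spectral_norm d \<Sigma>)"
  proof
    fix v
    show "integrable D (\<lambda>x. ip d v (centre m x))"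
      unfolding ip_def using c1 by (intro Bochner_Integration.integrable_sum) auto
    show "(\<integral>x. ip d v (centre m x) \<partial>D) = 0"
      unfolding ip_def using c1 by (subst Bochner_Integration.integral_sum) auto
    show "(\<integral>x. (ip d v (centre m x))\<^sup>2 \<partial>D) \<le> spectral_norm d \<Sigma> * ip d v v"
      unfolding E_sq by (rule form_le_spectral_norm[OF sym form tr])
  qed (fact meas int_sq int_norm E_norm)+
  show "spectral_norm d \<Sigma> \<le> mtrace d \<Sigma>"
    by (rule spectral_norm_le[OF sym form tr])
  show "0 < spectral_norm d \<Sigma>" if "\<exists>i<d. \<exists>j<d. \<Sigma> i j \<noteq> 0"
  proof (rule ccontr)
    assume "\<not> 0 < spectral_norm d \<Sigma>"
    then have "spectral_norm d \<Sigma> * ip d v v \<le> 0" for v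
      by (simp add: mult_nonpos_nonneg)
    then have zero: "ip d v (mat_vec d \<Sigma> v) = 0" for v
      using form_le_spectral_norm[of d \<Sigma>, OF sym form tr, of v] form_nonneg[of v]
      by (meson order.antisym order.trans)
    have "vnorm d (mat_vec d \<Sigma> v) \<le> 0 * vnorm d v" for v
      by (rule vnorm_mat_vec_le[OF sym]) (simp add: zero)
    then have "vnorm d (mat_vec d \<Sigma> v) = 0" for v
      using vnorm_nonneg[of d "mat_vec d \<Sigma> v"] by (simp add: order.antisym)
    then have "\<Sigma> i j = 0" if "i < d" "j < d" for i j
    proof -
      have "mat_vec d \<Sigma> (unit_vec j) i = 0"
        using \<open>\<And>v. vnorm d (mat_vec d \<Sigma> v) = 0\<close>[of "unit_vec j"] that(1)
        by (simp add: vnorm_def L2_set_eq_0_iff)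
      then show ?thesis
        using that(2) by (simp add: mat_vec_def unit_vec_def if_distrib cong: if_cong)
    qed
    then show False using that by blast
  qed
qed

section \<open>Good subsamples\<close>

text \<open>Both moments are normalised by the size of the full sample. The subsample may depend on
  the unknown mean, since the guarantee of a stability-based algorithm asks only that it
  exist.\<close>

definition good_subsample :: "nat \<Rightarrow> vect \<Rightarrow> real \<Rightarrow> real \<Rightarrow> real \<Rightarrow> vect multiset \<Rightarrow> vect multiset \<Rightarrow> bool" where
  "good_subsample d m \<eta> \<Lambda> D0 S S' \<longleftrightarrow>
     S' \<subseteq># S \<and> (1 - \<eta>) * real (size S) \<le> real (size S') \<and>
     (\<forall>v. (\<Sum>x\<in>#S'. (ip d (centre m x) v)\<^sup>2) \<le> real (size S) * \<Lambda> * ip d v v) \<and>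
     vnorm d (\<lambda>i. \<Sum>x\<in>#S'. centre m x i) \<le> real (size S) * D0"

text \<open>The scale \<sigma> = sqrt s2 cancels in \<sigma> \<delta>, so it leaves no trace in the
  error bound.\<close>

lemma stability_based_good_subsample:
  assumes alg: "stability_based C K A" and C: "0 < C" and d: "1 \<le> d" and m: "m \<in> Rd d"
    and \<eta>: "0 < \<eta>" "\<eta> \<le> 1 / 2" "C * \<eta> < 1 / 2" and \<epsilon>: "\<epsilon> \<le> \<eta>"
    and s2: "0 < s2" "s2 \<le> \<Lambda>"
    and S: "set_mset S \<subseteq> Rd d" "S \<noteq> {#}" and T: "corrupted_version d \<epsilon> S T"
    and good: "good_subsample d m \<eta> \<Lambda> D0 S S'"
  shows "vnorm d (\<lambda>i. result A d \<eta> T i - m i) \<le> 4 * K * (D0 + sqrt (C * \<eta> * \<Lambda>))"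
proof -
  have S': "S' \<subseteq># S" "(1 - \<eta>) * real (size S) \<le> real (size S')"
    using good by (auto simp: good_subsample_def)
  have "real (size S) / 2 \<le> (1 - \<eta>) * real (size S)"
    using \<eta> mult_right_mono[of "1/2" "1 - \<eta>" "real (size S)"] by simp
  then have half: "real (size S) / 2 \<le> real (size S')" using S' by linarith
  have "stable d (C * \<eta>) (4 * (D0 + sqrt (C * \<eta> * \<Lambda>)) / sqrt s2) m (sqrt s2) S'"
  proof (rule stable_of_moments[where n = "real (size S)"])
    show "real (size S') \<le> real (size S)" using S'(1) by (simp add: size_mset_mono)
  qed (use good S half \<eta> C s2 in \<open>auto simp: good_subsample_def nonempty_has_size\<close>)
  moreover have "corrupted_version d \<eta> S T"
  proof -
    have "\<epsilon> * real (size S) \<le> \<eta> * real (size S)" using \<epsilon> by (intro mult_right_mono) auto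
    moreover obtain R N where "R \<subseteq># S" "real (size R) \<le> \<epsilon> * real (size S)"
      "size N = size R" "set_mset N \<subseteq> Rd d" "T = S - R + N"
      using T unfolding corrupted_version_def by blast
    ultimately show ?thesis
      unfolding corrupted_version_def by (intro exI[of _ R] exI[of _ N]) auto
  qed
  ultimately have "vnorm d (\<lambda>i. result A d \<eta> T i - m i)
      \<le> K * sqrt s2 * (4 * (D0 + sqrt (C * \<eta> * \<Lambda>)) / sqrt s2)"
    using alg d m S S' s2 unfolding stability_based_def by (meson real_sqrt_gt_zero)
  then show ?thesis using s2 by (simp add: mult_ac)
qed

section \<open>Moments of the whole sample, and the two regimes of n times \<eta>\<close>

lemma size_sample_multiset [simp]: "size (sample_multiset n x) = n"
  by (simp add: sample_multiset_def)

lemma sum_sample_multiset: "(\<Sum>y\<in>#sample_multiset n x. f y) = (\<Sum>i<n. f (x i))" for f :: "vect \<Rightarrow> real"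
  by (simp add: sample_multiset_def image_mset.compositionality o_def sum_unfold_sum_mset)

context centred_distribution
begin

text \<open>A further point y changes the quantity by \<open>2 <s, y> + 2 |y|^2\<close>, of mean 2
  t. The two summands are kept together so that one use of Markov's inequality controls
  both.\<close>

lemma first_second_moment_sample:
  "(\<integral>\<^sup>+x. ennreal (ip d (\<lambda>k. \<Sum>i<n. centre m (x i) k) (\<lambda>k. \<Sum>i<n. centre m (x i) k)
      + (\<Sum>i<n. ip d (centre m (x i)) (centre m (x i)))) \<partial>(\<Pi>\<^sub>M i\<in>{..<n}. D))
    \<le> ennreal (2 * real n * t)"
  and measurable_first_second_moment:
  "(\<lambda>x. ip d (\<lambda>k. \<Sum>i<n. centre m (x i) k) (\<lambda>k. \<Sum>i<n. centre m (x i) k)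
      + (\<Sum>i<n. ip d (centre m (x i)) (centre m (x i)))) \<in> borel_measurable (\<Pi>\<^sub>M i\<in>{..<n}. D)"
proof -
  define g where "g n x = ip d (\<lambda>k. \<Sum>i<n. centre m (x i) k) (\<lambda>k. \<Sum>i<n. centre m (x i) k)
      + (\<Sum>i<n. ip d (centre m (x i)) (centre m (x i)))" for n :: nat and x :: "nat \<Rightarrow> vect"
  have g0: "0 \<le> g n x" for n x by (auto simp: g_def intro!: add_nonneg_nonneg sum_nonneg)
  have t0: "0 \<le> t" unfolding expectation_norm[symmetric] by simp
  have meas: "g n \<in> borel_measurable (\<Pi>\<^sub>M i\<in>{..<n}. D)" for n
  proof -
    have [measurable]: "(\<lambda>x. centre m (x i) k) \<in> borel_measurable (\<Pi>\<^sub>M i\<in>{..<n}. D)"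
      if "i < n" "k < d" for i k
    proof -
      have "(\<lambda>x. x i k) \<in> borel_measurable (\<Pi>\<^sub>M i\<in>{..<n}. D)"
        using that by (intro measurable_compose[OF _ coord_measurable] measurable_component_singleton) auto
      then show ?thesis by (simp add: centre_def)
    qed
    show ?thesis unfolding g_def ip_def
      by (intro borel_measurable_add borel_measurable_sum borel_measurable_times) auto
  qed
  have step: "(\<integral>\<^sup>+y. ennreal (g (Suc n) (x(n := y))) \<partial>D) = ennreal (g n x + 2 * t)" for n x
  proof -
    let ?s = "\<lambda>k. \<Sum>i<n. centre m (x i) k"
    have eq: "g (Suc n) (x(n := y))
        = g n x + (2 * ip d ?s (centre m y) + 2 * ip d (centre m y) (centre m y))" for y
      by (simp add: g_def ip_add_left ip_add_right ip_commute[of d "centre m y" ?s])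
    have int: "integrable D (\<lambda>y. g n x + (2 * ip d ?s (centre m y) + 2 * ip d (centre m y) (centre m y)))"
      using integrable_linear integrable_norm by simp
    have "(\<integral>\<^sup>+y. ennreal (g (Suc n) (x(n := y))) \<partial>D)
        = ennreal (\<integral>y. g n x + (2 * ip d ?s (centre m y) + 2 * ip d (centre m y) (centre m y)) \<partial>D)"
      unfolding eq[symmetric] using int g0 unfolding eq[symmetric] by (intro nn_integral_eq_integral) auto
    also have "(\<integral>y. g n x + (2 * ip d ?s (centre m y) + 2 * ip d (centre m y) (centre m y)) \<partial>D)
        = g n x + 2 * t"
      using integrable_linear integrable_norm
      by (simp add: prob_space expectation_linear expectation_norm)
    finally show ?thesis .
  qed
  have "(\<integral>\<^sup>+x. ennreal (g n x) \<partial>(\<Pi>\<^sub>M i\<in>{..<n}. D)) \<le> ennreal (2 * real n * t)"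
  proof (induction n)
    case 0
    then show ?case by (simp add: g_def)
  next
    case (Suc n)
    interpret P: prob_space "\<Pi>\<^sub>M i\<in>{..<n}. D" by (intro prob_space_PiM prob_space_axioms)
    note [measurable] = meas[of n]
    have "(\<integral>\<^sup>+x. ennreal (g (Suc n) x) \<partial>(\<Pi>\<^sub>M i\<in>{..<Suc n}. D))
        = (\<integral>\<^sup>+x. ennreal (g n x + 2 * t) \<partial>(\<Pi>\<^sub>M i\<in>{..<n}. D))"
      using meas[of "Suc n"]
      by (subst nn_integral_PiM_lessThan_Suc[OF prob_space_axioms]) (simp_all add: step)
    also have "\<dots> = (\<integral>\<^sup>+x. ennreal (g n x) \<partial>(\<Pi>\<^sub>M i\<in>{..<n}. D)) + ennreal (2 * t)"
      using g0 t0 by (simp add: ennreal_plus nn_integral_add P.emeasure_space_1)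
    also have "\<dots> \<le> ennreal (2 * real n * t) + ennreal (2 * t)"
      by (intro add_right_mono Suc.IH)
    also have "\<dots> = ennreal (2 * real (Suc n) * t)"
      using t0 by (simp add: algebra_simps flip: ennreal_plus)
    finally show ?case .
  qed
  then show "(\<integral>\<^sup>+x. ennreal (ip d (\<lambda>k. \<Sum>i<n. centre m (x i) k) (\<lambda>k. \<Sum>i<n. centre m (x i) k)
      + (\<Sum>i<n. ip d (centre m (x i)) (centre m (x i)))) \<partial>(\<Pi>\<^sub>M i\<in>{..<n}. D))
    \<le> ennreal (2 * real n * t)" by (simp add: g_def)
  show "(\<lambda>x. ip d (\<lambda>k. \<Sum>i<n. centre m (x i) k) (\<lambda>k. \<Sum>i<n. centre m (x i) k)
      + (\<Sum>i<n. ip d (centre m (x i)) (centre m (x i)))) \<in> borel_measurable (\<Pi>\<^sub>M i\<in>{..<n}. D)"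
    using meas[of n] by (simp add: g_def[abs_def])
qed

text \<open>The whole sample serves as subsample; the price is t instead of s2 in the second
  moment.\<close>

lemma good_subsample_few_rejections:
  assumes n: "1 \<le> n" and t: "0 < t" and \<eta>: "0 < \<eta>"
  shows "with_probability_at_least (sample_space n D) (1 / 2)
    (\<lambda>x. \<exists>S'. good_subsample d m \<eta> (4 * t) (2 * sqrt (t / real n)) (sample_multiset n x) S')"
proof -
  let ?M = "\<Pi>\<^sub>M i\<in>{..<n}. D"
  interpret P: prob_space ?M by (intro prob_space_PiM prob_space_axioms)
  let ?s = "\<lambda>x k. \<Sum>i<n. centre m (x i) k"
  define g where "g x = ip d (?s x) (?s x) + (\<Sum>i<n. ip d (centre m (x i)) (centre m (x i)))"
    for x :: "nat \<Rightarrow> vect"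
  have [measurable]: "g \<in> borel_measurable ?M"
    using measurable_first_second_moment[of n] by (simp add: g_def[abs_def])
  \<comment> \<open>Twice the bound 2 n t on the mean, whence probability 1/2.\<close>
  define b where "b = 4 * real n * t"
  have b: "0 < b" using n t by (simp add: b_def)
  let ?E = "{x \<in> space ?M. g x \<le> b}"
  have "emeasure ?M {x \<in> space ?M. \<not> g x \<le> b}
      \<le> emeasure ?M {x \<in> space ?M. 1 \<le> ennreal (1 / b) * ennreal (g x)}"
  proof (rule emeasure_mono)
    have "1 \<le> ennreal (1 / b) * ennreal (g x)" if "\<not> g x \<le> b" for x
      using that b by (simp flip: ennreal_mult)
    then show "{x \<in> space ?M. \<not> g x \<le> b} \<subseteq> {x \<in> space ?M. 1 \<le> ennreal (1 / b) * ennreal (g x)}"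
      by blast
  qed measurable
  also have "\<dots> \<le> ennreal (1 / b) * (\<integral>\<^sup>+x. ennreal (g x) * indicator (space ?M) x \<partial>?M)"
    by (rule nn_integral_Markov_inequality) measurable
  also have "(\<integral>\<^sup>+x. ennreal (g x) * indicator (space ?M) x \<partial>?M) = (\<integral>\<^sup>+x. ennreal (g x) \<partial>?M)"
    by (intro nn_integral_cong) simp
  also have "ennreal (1 / b) * (\<integral>\<^sup>+x. ennreal (g x) \<partial>?M) \<le> ennreal (1 / b) * ennreal (2 * real n * t)"
    using first_second_moment_sample[of n] by (intro mult_left_mono) (simp_all add: g_def)
  also have "\<dots> = ennreal (1 / 2)"
    using n t b by (simp add: b_def flip: ennreal_mult)
  finally have "ennreal (measure ?M {x \<in> space ?M. \<not> g x \<le> b}) \<le> ennreal (1 / 2)"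
    unfolding P.emeasure_eq_measure .
  then have "measure ?M {x \<in> space ?M. \<not> g x \<le> b} \<le> 1 / 2"
    by (subst (asm) ennreal_le_iff) simp_all
  then have half: "1 / 2 \<le> measure ?M ?E"
    using P.prob_neg[of "\<lambda>x. g x \<le> b"] by simp
  have "good_subsample d m \<eta> (4 * t) (2 * sqrt (t / real n)) (sample_multiset n x) (sample_multiset n x)"
    if "x \<in> ?E" for x
    unfolding good_subsample_def sum_sample_multiset size_sample_multiset
  proof (intro conjI allI)
    have s: "ip d (?s x) (?s x) \<le> b" and tr: "(\<Sum>i<n. ip d (centre m (x i)) (centre m (x i))) \<le> b"
    proof -
      have "0 \<le> (\<Sum>i<n. ip d (centre m (x i)) (centre m (x i)))" by (intro sum_nonneg) simp
      moreover have "0 \<le> ip d (?s x) (?s x)" by simp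
      ultimately show "ip d (?s x) (?s x) \<le> b" "(\<Sum>i<n. ip d (centre m (x i)) (centre m (x i))) \<le> b"
        using that unfolding g_def by (simp_all only: mem_Collect_eq) linarith+
    qed
    show "(1 - \<eta>) * real n \<le> real n" using \<eta> by (simp add: algebra_simps)
    show "(\<Sum>i<n. (ip d (centre m (x i)) v)\<^sup>2) \<le> real n * (4 * t) * ip d v v" for v
    proof -
      have "(\<Sum>i<n. (ip d (centre m (x i)) v)\<^sup>2)
          \<le> (\<Sum>i<n. ip d (centre m (x i)) (centre m (x i)) * ip d v v)"
        by (intro sum_mono ip_Cauchy_Schwarz)
      also have "\<dots> \<le> b * ip d v v"
        using tr unfolding sum_distrib_right[symmetric] by (intro mult_right_mono) auto
      finally show ?thesis by (simp add: b_def mult_ac)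
    qed
    have "vnorm d (?s x) \<le> sqrt b" unfolding vnorm_eq using s by simp
    also have "b = (2 * real n)\<^sup>2 * (t / real n)"
      using n by (simp add: b_def power2_eq_square)
    also have "sqrt \<dots> = real n * (2 * sqrt (t / real n))"
      unfolding real_sqrt_mult real_sqrt_abs by simp
    finally show "vnorm d (?s x) \<le> real n * (2 * sqrt (t / real n))" .
  qed simp
  then show ?thesis
    unfolding with_probability_at_least_def sample_space_def
    using half by (intro bexI[of _ ?E]) (auto intro: exI[of _ "sample_multiset n _"])
qed

text \<open>All randomness sits in two tail events. Off them, \<open>length_selected\<close>,
  \<open>second_moment_selected\<close> and \<open>radius_selected\<close> give the size, the second
  moments and the sum of the kept points.\<close>

lemma good_subsample_many_rejections:
  fixes n :: nat
  assumes n: "1 \<le> n" and s2: "0 < s2" "s2 \<le> t" and eta: "0 < \<eta>" "3 \<le> real n * \<eta>"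
    and \<tau>: "0 < \<tau>" "ln (1 / \<tau>) \<le> real n * \<eta> / 8"
  defines "\<l> \<equiv> max 1 (ln (t / s2))"
  shows "with_probability_at_least (sample_space n D) (1 - \<tau>)
    (\<lambda>x. \<exists>S'. good_subsample d m \<eta> (150 * s2 + 96 * (t * \<l>) / (real n * \<eta>))
      (13 * sqrt (t / real n) + 5 * sqrt (s2 * \<eta>)) (sample_multiset n x) S')"
proof -
  let ?M = "\<Pi>\<^sub>M i\<in>{..<n}. D"
  interpret P: prob_space ?M by (intro prob_space_PiM prob_space_axioms)
  \<comment> \<open>The scores have mean at most 3 \<zeta>, so the exponential moment of the total
    cost is at most \<open>exp (6 \<zeta> n) = exp (n \<eta>/4)\<close>. The rest of the budget n
    \<eta> must hold ln (1/\<tau>) <= n \<eta>/8 and the ln 2 from halving \<tau>; here n \<eta> >=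
    3 enters.\<close>
  define \<zeta> where "\<zeta> = \<eta> / 24"
  define w where "w = real n * \<eta>"
  define r where "r = t / s2"
  \<comment> \<open>About the least exponent that \<open>second_moment_selected\<close> allows for
    total cost w; 1 <= \<l> absorbs the rounding in \<open>p_le\<close>.\<close>
  define p where "p = nat \<lceil>\<l> + exp 1 / r * w\<rceil>"
  define L where "L = t / \<zeta>"
  \<comment> \<open>The typical norm of a sum of n points. It balances b against L w/(2 b) = 12 b,
    and together they give 13 sqrt(t/n) per point.\<close>
  define b where "b = sqrt (real n * t)"
  have t: "0 < t" using s2 by linarith
  have \<zeta>: "0 < \<zeta>" using eta by (simp add: \<zeta>_def)
  have r: "1 \<le> r" using s2 by (simp add: r_def)
  have w: "0 < w" using n eta by (simp add: w_def)
  have \<l>: "1 \<le> \<l>" "ln r \<le> \<l>" by (simp_all add: \<l>_def r_def)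
  have pos: "0 < exp 1 / r * w" using r w by simp
  have p_ge: "\<l> + exp 1 / r * w \<le> real p"
    unfolding p_def by (rule real_nat_ceiling_ge)
  have p_le: "real p \<le> 2 * \<l> + exp 1 / r * w"
  proof -
    have "real p \<le> \<l> + exp 1 / r * w + 1"
      using \<l> pos unfolding p_def by linarith
    then show ?thesis using \<l> by linarith
  qed
  have p1: "1 \<le> p"
  proof -
    have "1 \<le> real p" using p_ge \<l> pos by linarith
    then show ?thesis by simp
  qed
  interpret random_selection D d m t s2 p L "s2 / \<zeta>" "sqrt (s2 / \<zeta>)" b r \<zeta>
    using t s2 \<zeta> n r p1 by unfold_locales (simp_all add: L_def b_def r_def)
  have tail: "real n * \<eta> / 4 + ln (1 / (\<tau> / 2)) \<le> w"
  proof -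
    have "ln (1 / (\<tau> / 2)) = ln 2 + ln (1 / \<tau>)" using \<tau> by (simp add: ln_div ln_mult)
    then show ?thesis using \<tau> eta ln2_le_25_over_36 unfolding w_def by linarith
  qed
  have [measurable]: "(\<lambda>x. \<Sum>i<n. cost (centred x) i) \<in> borel_measurable ?M"
    "(\<lambda>x. \<Sum>i<n. gain (centred x) i) \<in> borel_measurable ?M"
    by (intro borel_measurable_sum measurable_cost_gain; simp)+
  have m1: "measure ?M {x \<in> space ?M. \<not> (\<Sum>i<n. cost (centred x) i) \<le> w} \<le> \<tau> / 2"
    using \<tau> tail by (intro cost_tail) (simp_all add: \<zeta>_def mult_ac)
  have m2: "measure ?M {x \<in> space ?M. \<not> (\<Sum>i<n. gain (centred x) i) \<le> w} \<le> \<tau> / 2"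
  proof (rule gain_tail)
    have "0 \<le> real n * \<eta>" using eta by simp
    then have "3 * \<zeta> * real n \<le> real n * \<eta> / 4" by (simp add: \<zeta>_def mult_ac)
    then show "3 * \<zeta> * real n + ln (1 / (\<tau> / 2)) \<le> w" using tail by linarith
  qed (use \<tau> in simp)
  let ?E = "{x \<in> space ?M. (\<Sum>i<n. cost (centred x) i) \<le> w \<and> (\<Sum>i<n. gain (centred x) i) \<le> w}"
  have "measure ?M {x \<in> space ?M. \<not> ((\<Sum>i<n. cost (centred x) i) \<le> w \<and> (\<Sum>i<n. gain (centred x) i) \<le> w)}
      \<le> measure ?M ({x \<in> space ?M. \<not> (\<Sum>i<n. cost (centred x) i) \<le> w}
        \<union> {x \<in> space ?M. \<not> (\<Sum>i<n. gain (centred x) i) \<le> w})"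
    by (intro P.finite_measure_mono) auto
  also have "\<dots> \<le> measure ?M {x \<in> space ?M. \<not> (\<Sum>i<n. cost (centred x) i) \<le> w}
      + measure ?M {x \<in> space ?M. \<not> (\<Sum>i<n. gain (centred x) i) \<le> w}"
    by (intro measure_Un_le) auto
  finally have "measure ?M {x \<in> space ?M. \<not> ((\<Sum>i<n. cost (centred x) i) \<le> w
      \<and> (\<Sum>i<n. gain (centred x) i) \<le> w)} \<le> \<tau>" using m1 m2 by linarith
  then have prob: "1 - \<tau> \<le> measure ?M ?E"
    using P.prob_neg[of "\<lambda>x. (\<Sum>i<n. cost (centred x) i) \<le> w \<and> (\<Sum>i<n. gain (centred x) i) \<le> w"]
    by simp
  have good: "good_subsample d m \<eta> (150 * s2 + 96 * (t * \<l>) / (real n * \<eta>))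
      (13 * sqrt (t / real n) + 5 * sqrt (s2 * \<eta>)) (sample_multiset n x)
      (image_mset (\<lambda>z k. z k + m k) (mset (selected (centred x) n)))"
    if "x \<in> ?E" for x
  proof -
    let ?zs = "selected (centred x) n"
    let ?S' = "image_mset (\<lambda>z k. z k + m k) (mset ?zs)"
    have cost: "(\<Sum>i<n. cost (centred x) i) \<le> w" and gain: "(\<Sum>i<n. gain (centred x) i) \<le> w"
      using that by auto
    have sum_S': "(\<Sum>y\<in>#?S'. f (centre m y)) = (\<Sum>z\<leftarrow>?zs. f z)" for f :: "vect \<Rightarrow> real"
      by (simp add: centre_def image_mset.compositionality o_def flip: sum_mset_sum_list)
    show ?thesis
      unfolding good_subsample_def size_sample_multiset
    proof (intro conjI allI)
      have "?S' \<subseteq># image_mset (\<lambda>z k. z k + m k) (image_mset (centred x) (mset_set {..<n}))"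
        by (intro image_mset_subseteq_mono mset_selected)
      also have "\<dots> = sample_multiset n x"
        by (simp add: sample_multiset_def centre_def image_mset.compositionality o_def)
      finally show "?S' \<subseteq># sample_multiset n x" .
      have "real n - w \<le> real (length ?zs)" using length_selected[of n "centred x"] cost by linarith
      then show "(1 - \<eta>) * real n \<le> real (size ?S')" by (simp add: w_def algebra_simps)
      show "(\<Sum>y\<in>#?S'. (ip d (centre m y) v)\<^sup>2)
          \<le> real n * (150 * s2 + 96 * (t * \<l>) / (real n * \<eta>)) * ip d v v" for v
      proof -
        have "exp 1 / r * (\<Sum>i<n. cost (centred x) i) \<le> exp 1 / r * w"
          using cost r by (intro mult_left_mono) auto
        then have "ln r + exp 1 / r * (\<Sum>i<n. cost (centred x) i) \<le> real p"
          using p_ge \<l> by linarith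
        then have "(\<Sum>z\<leftarrow>?zs. (ip d z v)\<^sup>2) \<le> 2 * c * ip d v v"
          by (rule second_moment_selected)
        also have "\<dots> \<le> real n * (150 * s2 + 96 * (t * \<l>) / (real n * \<eta>)) * ip d v v"
        proof (intro mult_right_mono)
          \<comment> \<open>Here L = 24 t/\<eta> and t/r = s2. The part 2 \<l> of the bound on p
            gives the trace term; the part in w gives 48 e n s2, with 48 e <= 144.\<close>
          have "2 * c \<le> 2 * ((2 * \<l> + exp 1 / r * w) * L)"
            unfolding c_def using p_le L by (intro mult_left_mono mult_right_mono) auto
          also have "\<dots> = 96 * (t * \<l>) / \<eta> + 48 * exp 1 * (real n * s2)"
            using eta s2 t by (simp add: L_def \<zeta>_def r_def w_def field_simps)
          also have "\<dots> \<le> 96 * (t * \<l>) / \<eta> + 150 * (real n * s2)"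
            using exp_le s2 by (intro add_left_mono mult_right_mono) auto
          also have "\<dots> = real n * (150 * s2 + 96 * (t * \<l>) / (real n * \<eta>))"
            using n eta by (simp add: field_simps)
          finally show "2 * c \<le> real n * (150 * s2 + 96 * (t * \<l>) / (real n * \<eta>))" .
        qed simp
        finally show ?thesis using sum_S'[of "\<lambda>z. (ip d z v)\<^sup>2"] by simp
      qed
      have "(\<lambda>i. \<Sum>y\<in>#?S'. centre m y i) = vsum ?zs"
        unfolding vsum_def using sum_S'[of "\<lambda>z. z i" for i] by (intro ext) auto
      then have "vnorm d (\<lambda>i. \<Sum>y\<in>#?S'. centre m y i) = sqrt (ip d (vsum ?zs) (vsum ?zs))"
        by (simp add: vnorm_eq)
      also have "\<dots> \<le> radius ?zs" unfolding radius_def by (intro real_sqrt_le_mono) simp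
      also have "\<dots> \<le> b + sqrt (s2 / \<zeta>) * (\<Sum>i<n. gain (centred x) i)
          + L / (2 * b) * (\<Sum>i<n. cost (centred x) i)"
        by (rule radius_selected)
      also have "\<dots> \<le> b + sqrt (s2 / \<zeta>) * w + L / (2 * b) * w"
        using cost gain L Q b by (intro add_mono mult_left_mono) auto
      also have "\<dots> \<le> real n * (13 * sqrt (t / real n) + 5 * sqrt (s2 * \<eta>))"
      proof -
        define y where "y = sqrt (t / real n)"
        have y: "0 < y" "t = real n * y\<^sup>2" using n t by (simp_all add: y_def)
        have b: "b = real n * y" using y n by (simp add: b_def real_sqrt_mult)
        have "L / (2 * b) * w = 12 * (real n * y)"
          using y n eta unfolding L_def b \<zeta>_def w_def y(2) by (simp add: field_simps power2_eq_square)
        \<comment> \<open>The left side is sqrt(24 s2 \<eta>), and 24 <= 25.\<close>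
        moreover have "sqrt (s2 / \<zeta>) * \<eta> \<le> 5 * sqrt (s2 * \<eta>)"
        proof -
          have "sqrt (s2 / \<zeta>) * \<eta> = sqrt (s2 / \<zeta> * \<eta>\<^sup>2)"
            using eta by (simp only: real_sqrt_mult real_sqrt_abs abs_of_pos)
          also have "\<dots> \<le> sqrt (5\<^sup>2 * (s2 * \<eta>))"
            using eta s2 by (intro real_sqrt_le_mono) (simp add: \<zeta>_def power2_eq_square)
          also have "\<dots> = 5 * sqrt (s2 * \<eta>)" unfolding real_sqrt_mult real_sqrt_abs by simp
          finally show ?thesis .
        qed
        then have "real n * (sqrt (s2 / \<zeta>) * \<eta>) \<le> real n * (5 * sqrt (s2 * \<eta>))"
          by (intro mult_left_mono) auto
        ultimately show ?thesis unfolding b y_def[symmetric] w_def by (simp add: algebra_simps)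
      qed
      finally show "vnorm d (\<lambda>i. \<Sum>y\<in>#?S'. centre m y i)
          \<le> real n * (13 * sqrt (t / real n) + 5 * sqrt (s2 * \<eta>))" .
    qed
  qed
  have "?E \<in> sets ?M" by measurable
  then show ?thesis
    unfolding with_probability_at_least_def sample_space_def
    using prob good by (intro bexI[of _ ?E]) blast+
qed

end

section \<open>Choice of the constants and the final error bound\<close>

lemma with_probability_at_least_mono:
  assumes "with_probability_at_least M q P" "q' \<le> q" "\<And>x. x \<in> space M \<Longrightarrow> P x \<Longrightarrow> P' x"
  shows "with_probability_at_least M q' P'"
  using assms sets.sets_into_space unfolding with_probability_at_least_def by (meson order.trans subsetD)

theorem proposition1p5:
  fixes C_A K_A :: real
  assumes "C_A > 0" and "K_A > 0"
  shows "\<exists>C1>0. \<exists>C2>0. \<exists>c>0. \<forall>A. stability_based C_A K_A A \<longrightarrow>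
    (\<exists>p. \<forall>(d::nat) (n::nat) (\<epsilon>::real) (\<tau>::real) D T \<mu> \<Sigma> \<epsilon>'.
       d \<ge> 1 \<and> n \<ge> 1 \<and> 0 < \<epsilon> \<and> \<epsilon> < 1/2 \<and> 0 < \<tau> \<and> \<tau> < 1 \<and>
       distribution_on_Rd d D \<and> finite_covariance d D \<and>
       \<mu> = mean_vec d D \<and> \<Sigma> = covariance d D \<and> (\<exists>i<d. \<exists>j<d. \<Sigma> i j \<noteq> 0) \<and>
       corrupted_samples d \<epsilon> n D T \<and>
       \<epsilon>' = C1 * (ln (1/\<tau>) / real n + \<epsilon>) \<and> \<epsilon>' \<le> c
       \<longrightarrow>
       (\<forall>x \<in> space (sample_space n D). runs_within A p d \<epsilon>' (T x)) \<and>
       with_probability_at_least (sample_space n D) (1 - \<tau>)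
         (\<lambda>x. vnorm d (\<lambda>i. result A d \<epsilon>' (T x) i - \<mu> i)
            \<le> C2 * (sqrt (mtrace d \<Sigma> * max 1 (ln (effective_rank d \<Sigma>)) / real n)
                  + sqrt (spectral_norm d \<Sigma> * \<epsilon>)
                  + sqrt (spectral_norm d \<Sigma> * ln (1/\<tau>) / real n))))"
proof -
  \<comment> \<open>The factor 4 K_A comes from \<open>stability_based_good_subsample\<close>; 15
    and 39 come from the bounds on \<open>D0\<close> and on sqrt(\<epsilon>' \<Lambda>) by multiples
    of a + e below.\<close>
  have C2: "0 < 4 * K_A * (15 + 39 * sqrt C_A)" using assms by (simp add: add_pos_pos)
  \<comment> \<open>The first bound keeps at least half of the sample; the second makes the
    stability parameter C_A \<epsilon>' at most 1/4.\<close>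
  have c: "0 < min (1 / 2) (1 / (4 * C_A))" using assms by simp
  show ?thesis
  \<comment> \<open>C1 = 8 turns the definition of \<epsilon>' into ln (1/\<tau>) <= n
    \<epsilon>'/8, the share left for the confidence term.\<close>
  proof (rule exI[of _ 8], rule conjI[OF zero_less_numeral], rule exI, rule conjI[OF C2],
      rule exI, rule conjI[OF c], intro allI impI)
    fix A assume alg: "stability_based C_A K_A A"
    then obtain p where p: "\<And>d \<eta> T. 1 \<le> d \<Longrightarrow> set_mset T \<subseteq> Rd d \<Longrightarrow> runs_within A p d \<eta> T"
      unfolding stability_based_def polynomial_time_def by blast
    show "\<exists>p. \<forall>(d::nat) (n::nat) (\<epsilon>::real) (\<tau>::real) D T \<mu> \<Sigma> \<epsilon>'.
       d \<ge> 1 \<and> n \<ge> 1 \<and> 0 < \<epsilon> \<and> \<epsilon> < 1/2 \<and> 0 < \<tau> \<and> \<tau> < 1 \<and>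
       distribution_on_Rd d D \<and> finite_covariance d D \<and>
       \<mu> = mean_vec d D \<and> \<Sigma> = covariance d D \<and> (\<exists>i<d. \<exists>j<d. \<Sigma> i j \<noteq> 0) \<and>
       corrupted_samples d \<epsilon> n D T \<and>
       \<epsilon>' = 8 * (ln (1/\<tau>) / real n + \<epsilon>) \<and> \<epsilon>' \<le> min (1 / 2) (1 / (4 * C_A))
       \<longrightarrow>
       (\<forall>x \<in> space (sample_space n D). runs_within A p d \<epsilon>' (T x)) \<and>
       with_probability_at_least (sample_space n D) (1 - \<tau>)
         (\<lambda>x. vnorm d (\<lambda>i. result A d \<epsilon>' (T x) i - \<mu> i)
            \<le> 4 * K_A * (15 + 39 * sqrt C_A) * (sqrt (mtrace d \<Sigma> * max 1 (ln (effective_rank d \<Sigma>)) / real n)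
                  + sqrt (spectral_norm d \<Sigma> * \<epsilon>)
                  + sqrt (spectral_norm d \<Sigma> * ln (1/\<tau>) / real n)))"
    proof (rule exI[of _ p], intro allI impI, elim conjE)
      fix d n :: nat and \<epsilon> \<tau> :: real and D T \<mu> \<Sigma> \<epsilon>'
      assume d: "1 \<le> d" and n: "1 \<le> n" and \<epsilon>: "0 < \<epsilon>" and \<tau>: "0 < \<tau>" "\<tau> < 1"
        and dist: "distribution_on_Rd d D" and fin: "finite_covariance d D"
        and \<mu>: "\<mu> = mean_vec d D" and \<Sigma>: "\<Sigma> = covariance d D"
        and nonzero: "\<exists>i<d. \<exists>j<d. \<Sigma> i j \<noteq> 0"
        and T: "corrupted_samples d \<epsilon> n D T"
        and \<epsilon>': "\<epsilon>' = 8 * (ln (1/\<tau>) / real n + \<epsilon>)" "\<epsilon>' \<le> min (1 / 2) (1 / (4 * C_A))"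
      define t where "t = mtrace d \<Sigma>"
      define s2 where "s2 = spectral_norm d \<Sigma>"
      define \<l> where "\<l> = max 1 (ln (t / s2))"
      note cov = centred_distribution_covariance[OF dist fin, folded \<mu> \<Sigma>, folded t_def s2_def]
      interpret centred_distribution D d \<mu> t s2 by (rule cov(1))
      have s2: "0 < s2" "s2 \<le> t" using cov nonzero by auto
      then have t: "0 < t" by linarith
      have \<mu>_Rd: "\<mu> \<in> Rd d" by (simp add: \<mu> mean_vec_def Rd_def)
      have lnpos: "0 < ln (1 / \<tau>)" using \<tau> by simp
      have \<epsilon>'_pos: "0 < \<epsilon>'" using lnpos \<epsilon> n unfolding \<epsilon>'(1) by (simp add: add_pos_pos)
      have \<epsilon>'_ge: "\<epsilon> \<le> \<epsilon>'" using lnpos \<epsilon> n unfolding \<epsilon>'(1) by (simp add: add_nonneg_nonneg)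
      have \<epsilon>'_half: "\<epsilon>' \<le> 1 / 2" using \<epsilon>' by simp
      have "C_A * \<epsilon>' \<le> C_A * (1 / (4 * C_A))" using \<epsilon>'(2) assms by (intro mult_left_mono) auto
      then have C\<epsilon>': "C_A * \<epsilon>' < 1 / 2" using assms by simp
      have ln_le: "ln (1 / \<tau>) \<le> real n * \<epsilon>' / 8"
        unfolding \<epsilon>'(1) using n \<epsilon> by (simp add: field_simps)
      have sample_Rd: "set_mset (sample_multiset n x) \<subseteq> Rd d" if "x \<in> space (sample_space n D)" for x
      proof -
        have "space D = Rd d"
          using dist sets_eq_imp_space_eq[of D "borel_Rd d"]
          by (simp add: distribution_on_Rd_def Rd_def space_PiM)
        then show ?thesis using that by (auto simp: sample_multiset_def sample_space_def space_PiM)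
      qed
      have T': "corrupted_version d \<epsilon> (sample_multiset n x) (T x)" if "x \<in> space (sample_space n D)" for x
        using T that by (simp add: corrupted_samples_def)
      have runtime: "runs_within A p d \<epsilon>' (T x)" if x: "x \<in> space (sample_space n D)" for x
      proof (rule p[OF d])
        obtain R N where N: "set_mset N \<subseteq> Rd d" and Tx: "T x = sample_multiset n x - R + N"
          using T'[OF x] unfolding corrupted_version_def by blast
        have "set_mset (sample_multiset n x - R) \<subseteq> Rd d"
          using sample_Rd[OF x] in_diffD by fastforce
        then show "set_mset (T x) \<subseteq> Rd d" using N unfolding Tx by simp
      qed
      define a where "a = sqrt (t * \<l> / real n)"
      define e where "e = sqrt (s2 * \<epsilon>) + sqrt (s2 * ln (1 / \<tau>) / real n)"
      have a0: "0 \<le> a" and e0: "0 \<le> e"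
        using t s2 \<epsilon> lnpos by (simp_all add: a_def e_def \<l>_def)
      have a2: "a\<^sup>2 = t * \<l> / real n" using t by (simp add: a_def \<l>_def)
      have ta: "t / real n \<le> a\<^sup>2"
        unfolding a2 using t mult_left_mono[of 1 \<l> t] by (intro divide_right_mono) (auto simp: \<l>_def)
      have sqrt_ta: "sqrt (t / real n) \<le> a"
        using ta a0 by (intro real_le_lsqrt) auto
      have e2: "s2 * \<epsilon>' \<le> 8 * e\<^sup>2"
      proof -
        have "s2 * \<epsilon>' = 8 * ((sqrt (s2 * \<epsilon>))\<^sup>2 + (sqrt (s2 * ln (1 / \<tau>) / real n))\<^sup>2)"
          unfolding \<epsilon>'(1) using s2 \<epsilon> lnpos by (simp add: algebra_simps)
        also have "\<dots> \<le> 8 * e\<^sup>2"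
          unfolding e_def power2_sum using s2 \<epsilon> lnpos by simp
        finally show ?thesis .
      qed
      have sqrt_e: "sqrt (s2 * \<epsilon>') \<le> 3 * e"
      proof (rule real_le_lsqrt)
        have "8 * e\<^sup>2 \<le> (3 * e)\<^sup>2" by (simp add: power_mult_distrib)
        then show "s2 * \<epsilon>' \<le> (3 * e)\<^sup>2" using e2 by linarith
      qed (use e0 in simp)
      have sqrtC: "0 \<le> sqrt C_A" using assms by simp

      \<comment> \<open>Here \<open>a\<close> is the first term of the rate and \<open>e\<close> the
        sum of the other two; the coefficients are large enough for both regimes.\<close>
      have bound: "with_probability_at_least (sample_space n D) (1 - \<tau>)
          (\<lambda>x. vnorm d (\<lambda>i. result A d \<epsilon>' (T x) i - \<mu> i) \<le> 4 * K_A * (15 + 39 * sqrt C_A) * (a + e))"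
        if good: "with_probability_at_least (sample_space n D) (1 - \<tau>)
            (\<lambda>x. \<exists>S'. good_subsample d \<mu> \<epsilon>' \<Lambda> D0 (sample_multiset n x) S')"
          and \<Lambda>: "s2 \<le> \<Lambda>" "\<epsilon>' * \<Lambda> \<le> (10 * a + 39 * e)\<^sup>2" and D0: "D0 \<le> 13 * a + 15 * e" for \<Lambda> D0
      proof (rule with_probability_at_least_mono[OF good order.refl])
        fix x assume x: "x \<in> space (sample_space n D)"
          and "\<exists>S'. good_subsample d \<mu> \<epsilon>' \<Lambda> D0 (sample_multiset n x) S'"
        then obtain S' where S': "good_subsample d \<mu> \<epsilon>' \<Lambda> D0 (sample_multiset n x) S'" by blast
        have ne: "sample_multiset n x \<noteq> {#}"
        proof
          assume "sample_multiset n x = {#}"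
          then have "size (sample_multiset n x) = size ({#} :: vect multiset)" by (rule arg_cong)
          then show False using n by simp
        qed
        have "vnorm d (\<lambda>i. result A d \<epsilon>' (T x) i - \<mu> i) \<le> 4 * K_A * (D0 + sqrt (C_A * \<epsilon>' * \<Lambda>))"
          by (rule stability_based_good_subsample[OF alg assms(1) d \<mu>_Rd \<epsilon>'_pos \<epsilon>'_half C\<epsilon>' \<epsilon>'_ge
                s2(1) \<Lambda>(1) sample_Rd[OF x] ne T'[OF x] S'])
        also have "\<dots> \<le> 4 * K_A * ((15 + 39 * sqrt C_A) * (a + e))"
        proof (intro mult_left_mono)
          have "sqrt (\<epsilon>' * \<Lambda>) \<le> 10 * a + 39 * e"
            using \<Lambda>(2) a0 e0 by (intro real_le_lsqrt) auto
          then have "sqrt C_A * sqrt (\<epsilon>' * \<Lambda>) \<le> sqrt C_A * (39 * (a + e))"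
            using sqrtC a0 by (intro mult_left_mono) auto
          then have "D0 + sqrt (C_A * \<epsilon>' * \<Lambda>) \<le> 15 * (a + e) + sqrt C_A * (39 * (a + e))"
            using D0 a0 by (simp add: real_sqrt_mult mult.assoc)
          then show "D0 + sqrt (C_A * \<epsilon>' * \<Lambda>) \<le> (15 + 39 * sqrt C_A) * (a + e)"
            by (simp add: algebra_simps)
        qed (use assms in simp)
        finally show "vnorm d (\<lambda>i. result A d \<epsilon>' (T x) i - \<mu> i)
            \<le> 4 * K_A * (15 + 39 * sqrt C_A) * (a + e)" by (simp add: mult.assoc)
      qed
      have prob: "with_probability_at_least (sample_space n D) (1 - \<tau>)
          (\<lambda>x. vnorm d (\<lambda>i. result A d \<epsilon>' (T x) i - \<mu> i) \<le> 4 * K_A * (15 + 39 * sqrt C_A) * (a + e))"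
      proof (cases "3 \<le> real n * \<epsilon>'")
        case True
        show ?thesis
        proof (rule bound)
          show "with_probability_at_least (sample_space n D) (1 - \<tau>)
              (\<lambda>x. \<exists>S'. good_subsample d \<mu> \<epsilon>' (150 * s2 + 96 * (t * \<l>) / (real n * \<epsilon>'))
                (13 * sqrt (t / real n) + 5 * sqrt (s2 * \<epsilon>')) (sample_multiset n x) S')"
            unfolding \<l>_def
            by (rule good_subsample_many_rejections[OF n s2 \<epsilon>'_pos True \<tau>(1) ln_le])
          show "s2 \<le> 150 * s2 + 96 * (t * \<l>) / (real n * \<epsilon>')"
          proof -
            have "0 \<le> 96 * (t * \<l>) / (real n * \<epsilon>')" using t \<epsilon>'_pos by (simp add: \<l>_def)
            then show ?thesis using s2 by linarith
          qed
          have "\<epsilon>' * (150 * s2 + 96 * (t * \<l>) / (real n * \<epsilon>')) = 150 * (s2 * \<epsilon>') + 96 * a\<^sup>2"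
            using \<epsilon>'_pos n by (simp add: a2 field_simps)
          also have "\<dots> \<le> 150 * (8 * e\<^sup>2) + 96 * a\<^sup>2" using e2 by linarith
          \<comment> \<open>96 <= 10^2 and 150 * 8 = 1200 <= 39^2.\<close>
          also have "\<dots> \<le> (10 * a)\<^sup>2 + (39 * e)\<^sup>2 + 2 * (10 * a) * (39 * e)"
          proof -
            have "0 \<le> a * e" using a0 e0 by simp
            then show ?thesis
              using zero_le_power2[of a] zero_le_power2[of e] unfolding power_mult_distrib by simp
          qed
          also have "\<dots> = (10 * a + 39 * e)\<^sup>2" by (simp add: power2_sum)
          finally show "\<epsilon>' * (150 * s2 + 96 * (t * \<l>) / (real n * \<epsilon>')) \<le> (10 * a + 39 * e)\<^sup>2" .
          show "13 * sqrt (t / real n) + 5 * sqrt (s2 * \<epsilon>') \<le> 13 * a + 15 * e"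
            using sqrt_ta sqrt_e by linarith
        qed
      next
        case False
        \<comment> \<open>Since 3/8 < 2/3 <= ln 2, the required probability drops to 1/2, within
          reach of Markov's inequality.\<close>
        have "ln (1 / \<tau>) \<le> 3 / 8" using ln_le False by linarith
        then have "ln (1 / \<tau>) \<le> ln 2" using ln2_ge_two_thirds by linarith
        then have \<tau>_half: "1 - \<tau> \<le> 1 / 2" using \<tau> by (simp add: field_simps)
        show ?thesis
        proof (rule bound)
          show "with_probability_at_least (sample_space n D) (1 - \<tau>)
              (\<lambda>x. \<exists>S'. good_subsample d \<mu> \<epsilon>' (4 * t) (2 * sqrt (t / real n)) (sample_multiset n x) S')"
            by (rule with_probability_at_least_mono[OF
                good_subsample_few_rejections[OF n t \<epsilon>'_pos] \<tau>_half])
          show "s2 \<le> 4 * t" using s2 t by linarith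
          \<comment> \<open>In this regime \<epsilon>' t is at most 3 t/n, so the coarse second
            moment 4 t costs only a constant times the first term of the rate.\<close>
          have "\<epsilon>' \<le> 3 / real n" using False n by (simp add: field_simps)
          then have "\<epsilon>' * (4 * t) \<le> 3 / real n * (4 * t)" using t by (intro mult_right_mono) auto
          also have "\<dots> = 12 * (t / real n)" by simp
          also have "\<dots> \<le> 12 * a\<^sup>2" using ta by linarith
          also have "\<dots> \<le> (10 * a)\<^sup>2" by (simp add: power_mult_distrib)
          also have "\<dots> \<le> (10 * a + 39 * e)\<^sup>2" using a0 e0 by (intro power_mono) auto
          finally show "\<epsilon>' * (4 * t) \<le> (10 * a + 39 * e)\<^sup>2" .
          show "2 * sqrt (t / real n) \<le> 13 * a + 15 * e"
            using sqrt_ta a0 e0 by linarith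
        qed
      qed
      show "(\<forall>x \<in> space (sample_space n D). runs_within A p d \<epsilon>' (T x)) \<and>
        with_probability_at_least (sample_space n D) (1 - \<tau>)
         (\<lambda>x. vnorm d (\<lambda>i. result A d \<epsilon>' (T x) i - \<mu> i)
            \<le> 4 * K_A * (15 + 39 * sqrt C_A) * (sqrt (mtrace d \<Sigma> * max 1 (ln (effective_rank d \<Sigma>)) / real n)
                  + sqrt (spectral_norm d \<Sigma> * \<epsilon>)
                  + sqrt (spectral_norm d \<Sigma> * ln (1/\<tau>) / real n)))"
        using runtime prob
        unfolding a_def e_def \<l>_def t_def s2_def effective_rank_def by (simp add: add.assoc)
    qed
  qed
qed

end
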